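(* Let $A\in M(n,\widetilde{\mathbb R})$ be skew-symmetric, and let $(\theta_1,\dots,\theta_n)\in\widetilde{\mathbb C}^n$ be its distinguished $n$-tuple of eigenvalues (defined in the context). (i) There exists an orthogonal matrix $V\in M(n,\widetilde{\mathbb R})$ such that $V^tAV$ is of block-diagonal form $\mathrm{diag}(B_1,\dots,B_k,0,\dots,0)$, with each $B_j$ of the form $$B_j=\begin{pmatrix}0&-\lambda_j\\ \lambda_j&0\end{pmatrix},$$ followed by $1\times1$ blocks of zeros. Here, $\lambda_1\ge\dots\ge\lambda_k\ge0$ are elements of $\widetilde{\mathbb R}$ and $\pm i\lambda_j$ ($1\le j\le k$) are the non-zero entries of the $n$-tuple $(\theta_1,\dots,\theta_n)$. (ii) $A$ is non-degenerate if and only if each $\theta_k$ ($1\le k\le n$) is invertible in $\widetilde{\mathbb C}$. In this case there exists a non-degenerate matrix $V\in M(n,\widetilde{\mathbb R})$ such that $$V^tAV=\begin{pmatrix}0&-I\\ I&0\end{pmatrix}.$$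
   Context: For $\mathbb K=\mathbb R$ or $\mathbb C$, the ring of Colombeau generalized numbers is $\widetilde{\mathbb K}=\mathcal E_M/\mathcal N$, where $\mathcal E_M=\{(r_\varepsilon)_{\varepsilon\in(0,1]}\in\mathbb K^{(0,1]}:\exists N\in\mathbb N,\ |r_\varepsilon|=O(\varepsilon^{-N})\ (\varepsilon\to0)\}$ and $\mathcal N=\{(r_\varepsilon)_{\varepsilon\in(0,1]}\in\mathbb K^{(0,1]}:\forall m\in\mathbb N,\ |r_\varepsilon|=O(\varepsilon^{m})\ (\varepsilon\to0)\}$, with operations defined componentwise on representatives; $[(r_\varepsilon)_\varepsilon]$ denotes the class of $(r_\varepsilon)_\varepsilon$, and $\widetilde{\mathbb R}\subseteq\widetilde{\mathbb C}$. For $r,s\in\widetilde{\mathbb R}$, $r\ge s$ means that there are representatives with $r_\varepsilon\ge s_\varepsilon$ for all $\varepsilon$. $M(n,\widetilde{\mathbb K})$ is the set of $n\times n$ matrices with entries in $\widetilde{\mathbb K}$. A representative of $A\in M(n,\widetilde{\mathbb K})$ is a net $(A_\varepsilon)_{\varepsilon\in(0,1]}$ of matrices in $M(n,\mathbb K)$ whose entries are representatives of the entries of $A$. $A$ is skew-symmetric if $A^t=-A$; $V$ is orthogonal if $V^tV=I$. $A\in M(n,\widetilde{\mathbb R})$ is non-degenerate if for $x\in\widetilde{\mathbb R}^n$, $x^tAy=0$ for all $y\in\widetilde{\mathbb R}^n$ implies $x=0$. $I$ denotes an identity matrix of the appropriate size (in the last display, $n/2\times n/2$; $n$ is even whenever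 $A$ is non-degenerate). Distinguished $n$-tuple: for skew-symmetric $A=[(A_\varepsilon)_\varepsilon]\in M(n,\widetilde{\mathbb R})$ and each $\varepsilon$, let $\theta_{1,\varepsilon},\dots,\theta_{n,\varepsilon}\in\mathbb C$ be the eigenvalues of $A_\varepsilon$ (with multiplicity), ordered so that $\mathrm{Im}\,\theta_{1,\varepsilon}\ge\dots\ge\mathrm{Im}\,\theta_{n,\varepsilon}$, and set $\theta_k:=[(\theta_{k,\varepsilon})_\varepsilon]\in\widetilde{\mathbb C}$. These are well defined, independently of the chosen representative $(A_\varepsilon)_\varepsilon$. *)

theory Defs
  imports "HOL-Library.Landau_Symbols" "HOL-Library.Multiset" "Jordan_Normal_Form.Char_Poly"
begin

text \<open>
  A net \<open>(r\<^sub>\<epsilon>)\<close>, indexed by \<open>\<epsilon> \<in> (0,1]\<close>, is a function on \<open>real\<close> whose values outside \<open>(0,1]\<close> are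
  irrelevant: moderateness and negligibility only depend on the germ of the net at \<open>0+\<close>, hence so do
  the elements of the quotient.
\<close>

definition moderate :: "(real \<Rightarrow> 'a::real_normed_field) \<Rightarrow> bool" where
  "moderate r \<longleftrightarrow> (\<exists>N::nat. (\<lambda>\<epsilon>. norm (r \<epsilon>)) \<in> O[at_right 0](\<lambda>\<epsilon>. (1 / \<epsilon>) ^ N))"

definition negligible_net :: "(real \<Rightarrow> 'a::real_normed_field) \<Rightarrow> bool" where
  "negligible_net r \<longleftrightarrow> (\<forall>m::nat. (\<lambda>\<epsilon>. norm (r \<epsilon>)) \<in> O[at_right 0](\<lambda>\<epsilon>. \<epsilon> ^ m))"

definition net_rel :: "(real \<Rightarrow> 'a::real_normed_field) \<Rightarrow> (real \<Rightarrow> 'a) \<Rightarrow> bool" where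
  "net_rel r s \<longleftrightarrow> moderate r \<and> moderate s \<and> negligible_net (\<lambda>\<epsilon>. r \<epsilon> - s \<epsilon>)"

lemma eventually_at_right_unit: "eventually (\<lambda>\<epsilon>::real. \<epsilon> \<in> {0<..<1}) (at_right 0)"
  by (rule eventually_at_right_real) simp

lemma moderate_const: "moderate (\<lambda>\<epsilon>. c)"
  unfolding moderate_def by (rule exI[of _ 0]) simp

lemma moderate_norm_le:
  assumes "moderate s" "eventually (\<lambda>\<epsilon>. norm (r \<epsilon>) \<le> norm (s \<epsilon>)) (at_right 0)"
  shows "moderate r"
proof -
  have "(\<lambda>\<epsilon>. norm (r \<epsilon>)) \<in> O[at_right 0](\<lambda>\<epsilon>. norm (s \<epsilon>))"
    by (rule landau_o.big_mono) (use assms(2) in simp)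
  then show ?thesis
    using assms(1) unfolding moderate_def by (meson landau_o.big_trans)
qed

lemma bigo_norm_add:
  fixes f g :: "real \<Rightarrow> 'a::real_normed_field" and h :: "real \<Rightarrow> real"
  assumes "(\<lambda>x. norm (f x)) \<in> O[F](h)" "(\<lambda>x. norm (g x)) \<in> O[F](h)"
  shows "(\<lambda>x. norm (f x + g x)) \<in> O[F](h)"
proof -
  have "(\<lambda>x. norm (f x + g x)) \<in> O[F](\<lambda>x. norm (f x) + norm (g x))"
    by (rule landau_o.big_mono) (simp add: norm_triangle_ineq)
  moreover have "(\<lambda>x. norm (f x) + norm (g x)) \<in> O[F](h)"
    using assms by (rule sum_in_bigo)
  ultimately show ?thesis by (rule landau_o.big_trans)
qed

lemma inverse_power_bigo_mono:
  assumes "N \<le> M"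
  shows "(\<lambda>\<epsilon>::real. (1 / \<epsilon>) ^ N) \<in> O[at_right 0](\<lambda>\<epsilon>. (1 / \<epsilon>) ^ M)"
proof (rule landau_o.big_mono)
  show "eventually (\<lambda>\<epsilon>::real. norm ((1 / \<epsilon>) ^ N) \<le> norm ((1 / \<epsilon>) ^ M)) (at_right 0)"
    using eventually_at_right_unit
  proof eventually_elim
    case (elim \<epsilon>)
    then have "(1 / \<epsilon>) ^ N \<le> (1 / \<epsilon>) ^ M"
      using assms by (intro power_increasing) auto
    then show ?case using elim by simp
  qed
qed

lemma moderate_add:
  assumes "moderate r" "moderate s"
  shows "moderate (\<lambda>\<epsilon>. r \<epsilon> + s \<epsilon>)"
proof -
  obtain N M where "(\<lambda>\<epsilon>. norm (r \<epsilon>)) \<in> O[at_right 0](\<lambda>\<epsilon>. (1 / \<epsilon>) ^ N)"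
      and "(\<lambda>\<epsilon>. norm (s \<epsilon>)) \<in> O[at_right 0](\<lambda>\<epsilon>. (1 / \<epsilon>) ^ M)"
    using assms unfolding moderate_def by blast
  then have "(\<lambda>\<epsilon>. norm (r \<epsilon> + s \<epsilon>)) \<in> O[at_right 0](\<lambda>\<epsilon>. (1 / \<epsilon>) ^ max N M)"
    by (intro bigo_norm_add landau_o.big_trans[OF _ inverse_power_bigo_mono[of _ "max N M"]]) auto
  then show ?thesis unfolding moderate_def by blast
qed

lemma moderate_uminus: "moderate (\<lambda>\<epsilon>. - r \<epsilon>) \<longleftrightarrow> moderate r"
  unfolding moderate_def by simp

lemma moderate_diff: "moderate r \<Longrightarrow> moderate s \<Longrightarrow> moderate (\<lambda>\<epsilon>. r \<epsilon> - s \<epsilon>)"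
  using moderate_add[of r "\<lambda>\<epsilon>. - s \<epsilon>"] by (simp add: moderate_uminus)

lemma moderate_mult:
  assumes "moderate r" "moderate s"
  shows "moderate (\<lambda>\<epsilon>. r \<epsilon> * s \<epsilon>)"
proof -
  obtain N M where "(\<lambda>\<epsilon>. norm (r \<epsilon>)) \<in> O[at_right 0](\<lambda>\<epsilon>. (1 / \<epsilon>) ^ N)"
      and "(\<lambda>\<epsilon>. norm (s \<epsilon>)) \<in> O[at_right 0](\<lambda>\<epsilon>. (1 / \<epsilon>) ^ M)"
    using assms unfolding moderate_def by blast
  then have "(\<lambda>\<epsilon>. norm (r \<epsilon> * s \<epsilon>)) \<in> O[at_right 0](\<lambda>\<epsilon>. (1 / \<epsilon>) ^ (N + M))"
    unfolding norm_mult power_add by (rule landau_o.big.mult)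
  then show ?thesis unfolding moderate_def by blast
qed

lemma negligible_net_zero: "negligible_net (\<lambda>\<epsilon>. 0)"
  unfolding negligible_net_def by simp

lemma negligible_net_add:
  "negligible_net r \<Longrightarrow> negligible_net s \<Longrightarrow> negligible_net (\<lambda>\<epsilon>. r \<epsilon> + s \<epsilon>)"
  unfolding negligible_net_def by (blast intro: bigo_norm_add)

lemma negligible_net_uminus: "negligible_net (\<lambda>\<epsilon>. - r \<epsilon>) \<longleftrightarrow> negligible_net r"
  unfolding negligible_net_def by simp

lemma negligible_net_mult:
  assumes "negligible_net r" "moderate s"
  shows "negligible_net (\<lambda>\<epsilon>. r \<epsilon> * s \<epsilon>)"
  unfolding negligible_net_def
proof
  fix m :: nat
  obtain N where N: "(\<lambda>\<epsilon>. norm (s \<epsilon>)) \<in> O[at_right 0](\<lambda>\<epsilon>. (1 / \<epsilon>) ^ N)"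
    using assms(2) unfolding moderate_def by blast
  have "(\<lambda>\<epsilon>. norm (r \<epsilon>)) \<in> O[at_right 0](\<lambda>\<epsilon>. \<epsilon> ^ (m + N))"
    using assms(1) unfolding negligible_net_def by blast
  from landau_o.big.mult[OF this N]
  have "(\<lambda>\<epsilon>. norm (r \<epsilon> * s \<epsilon>)) \<in> O[at_right 0](\<lambda>\<epsilon>. \<epsilon> ^ (m + N) * (1 / \<epsilon>) ^ N)"
    by (simp add: norm_mult)
  moreover have "eventually (\<lambda>\<epsilon>::real. \<epsilon> ^ (m + N) * (1 / \<epsilon>) ^ N = \<epsilon> ^ m) (at_right 0)"
    using eventually_at_right_unit
    by eventually_elim (simp add: power_add power_one_over)
  ultimately show "(\<lambda>\<epsilon>. norm (r \<epsilon> * s \<epsilon>)) \<in> O[at_right 0](\<lambda>\<epsilon>. \<epsilon> ^ m)"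
    by (simp only: landau_o.big.cong)
qed

lemma not_negligible_net_one: "\<not> negligible_net (\<lambda>\<epsilon>. 1 :: 'a::real_normed_field)"
proof
  assume "negligible_net (\<lambda>\<epsilon>. 1 :: 'a)"
  then have "(\<lambda>\<epsilon>::real. 1::real) \<in> O[at_right 0](\<lambda>\<epsilon>. \<epsilon> ^ 1)"
    unfolding negligible_net_def by (auto dest: spec[of _ 1])
  then obtain c where c: "c > 0" "eventually (\<lambda>\<epsilon>::real. 1 \<le> c * \<bar>\<epsilon>\<bar>) (at_right 0)"
    by (auto elim!: landau_o.bigE)
  have "eventually (\<lambda>\<epsilon>::real. \<epsilon> \<in> {0<..<1 / c}) (at_right 0)"
    using c by (intro eventually_at_right_real) simp
  with c(2) have "eventually (\<lambda>\<epsilon>::real. False) (at_right 0)"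
    by eventually_elim (use c(1) in \<open>simp add: field_simps\<close>)
  then show False by simp
qed

lemma part_equivp_net_rel: "part_equivp (net_rel :: (real \<Rightarrow> 'a::real_normed_field) \<Rightarrow> _)"
proof (rule part_equivpI)
  show "\<exists>r::real \<Rightarrow> 'a. net_rel r r"
    by (auto simp: net_rel_def moderate_const negligible_net_zero intro!: exI[of _ "\<lambda>_. 0"])
  show "symp (net_rel :: (real \<Rightarrow> 'a) \<Rightarrow> _)"
  proof (rule sympI)
    fix r s :: "real \<Rightarrow> 'a"
    assume "net_rel r s"
    then show "net_rel s r"
      using negligible_net_uminus[of "\<lambda>\<epsilon>. r \<epsilon> - s \<epsilon>"] by (simp add: net_rel_def)
  qed
  show "transp (net_rel :: (real \<Rightarrow> 'a) \<Rightarrow> _)"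
  proof (rule transpI)
    fix r s t :: "real \<Rightarrow> 'a"
    assume "net_rel r s" "net_rel s t"
    then show "net_rel r t"
      using negligible_net_add[of "\<lambda>\<epsilon>. r \<epsilon> - s \<epsilon>" "\<lambda>\<epsilon>. s \<epsilon> - t \<epsilon>"] by (simp add: net_rel_def)
  qed
qed

quotient_type (overloaded) 'a colombeau = "real \<Rightarrow> 'a::real_normed_field" / partial: net_rel
  by (rule part_equivp_net_rel)

definition represents :: "(real \<Rightarrow> 'a::real_normed_field) \<Rightarrow> 'a colombeau \<Rightarrow> bool" where
  "represents r x \<longleftrightarrow> moderate r \<and> abs_colombeau r = x"

lift_definition colombeau_const :: "'a::real_normed_field \<Rightarrow> 'a colombeau" is "\<lambda>c \<epsilon>. c"
  by (simp add: net_rel_def moderate_const negligible_net_zero)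

lift_definition complex_of_colombeau :: "real colombeau \<Rightarrow> complex colombeau"
  is "\<lambda>r \<epsilon>. complex_of_real (r \<epsilon>)"
  unfolding net_rel_def moderate_def negligible_net_def of_real_diff[symmetric] norm_of_real
  by simp

instantiation colombeau :: (real_normed_field) comm_ring_1
begin

lift_definition zero_colombeau :: "'a colombeau" is "\<lambda>\<epsilon>. 0"
  by (simp add: net_rel_def moderate_const negligible_net_zero)

lift_definition one_colombeau :: "'a colombeau" is "\<lambda>\<epsilon>. 1"
  by (simp add: net_rel_def moderate_const negligible_net_zero)

lift_definition plus_colombeau :: "'a colombeau \<Rightarrow> 'a colombeau \<Rightarrow> 'a colombeau"
  is "\<lambda>r s \<epsilon>. r \<epsilon> + s \<epsilon>"
proof -
  fix r r' s s' :: "real \<Rightarrow> 'a"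
  assume "net_rel r r'" "net_rel s s'"
  then show "net_rel (\<lambda>\<epsilon>. r \<epsilon> + s \<epsilon>) (\<lambda>\<epsilon>. r' \<epsilon> + s' \<epsilon>)"
    using negligible_net_add[of "\<lambda>\<epsilon>. r \<epsilon> - r' \<epsilon>" "\<lambda>\<epsilon>. s \<epsilon> - s' \<epsilon>"]
    by (simp add: net_rel_def moderate_add algebra_simps)
qed

lift_definition uminus_colombeau :: "'a colombeau \<Rightarrow> 'a colombeau" is "\<lambda>r \<epsilon>. - r \<epsilon>"
proof -
  fix r r' :: "real \<Rightarrow> 'a"
  assume "net_rel r r'"
  then show "net_rel (\<lambda>\<epsilon>. - r \<epsilon>) (\<lambda>\<epsilon>. - r' \<epsilon>)"
    using negligible_net_uminus[of "\<lambda>\<epsilon>. r \<epsilon> - r' \<epsilon>"]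
    by (simp add: net_rel_def moderate_uminus algebra_simps)
qed

lift_definition minus_colombeau :: "'a colombeau \<Rightarrow> 'a colombeau \<Rightarrow> 'a colombeau"
  is "\<lambda>r s \<epsilon>. r \<epsilon> - s \<epsilon>"
proof -
  fix r r' s s' :: "real \<Rightarrow> 'a"
  assume "net_rel r r'" "net_rel s s'"
  then show "net_rel (\<lambda>\<epsilon>. r \<epsilon> - s \<epsilon>) (\<lambda>\<epsilon>. r' \<epsilon> - s' \<epsilon>)"
    using negligible_net_add[of "\<lambda>\<epsilon>. r \<epsilon> - r' \<epsilon>" "\<lambda>\<epsilon>. - (s \<epsilon> - s' \<epsilon>)"]
      negligible_net_uminus[of "\<lambda>\<epsilon>. s \<epsilon> - s' \<epsilon>"]
    by (simp add: net_rel_def moderate_diff algebra_simps)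
qed

lift_definition times_colombeau :: "'a colombeau \<Rightarrow> 'a colombeau \<Rightarrow> 'a colombeau"
  is "\<lambda>r s \<epsilon>. r \<epsilon> * s \<epsilon>"
proof -
  fix r r' s s' :: "real \<Rightarrow> 'a"
  assume *: "net_rel r r'" "net_rel s s'"
  have "negligible_net (\<lambda>\<epsilon>. (r \<epsilon> - r' \<epsilon>) * s \<epsilon> + (s \<epsilon> - s' \<epsilon>) * r' \<epsilon>)"
    using * by (intro negligible_net_add negligible_net_mult) (auto simp: net_rel_def)
  also have "(\<lambda>\<epsilon>. (r \<epsilon> - r' \<epsilon>) * s \<epsilon> + (s \<epsilon> - s' \<epsilon>) * r' \<epsilon>) = (\<lambda>\<epsilon>. r \<epsilon> * s \<epsilon> - r' \<epsilon> * s' \<epsilon>)"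
    by (rule ext) (simp add: algebra_simps)
  finally show "net_rel (\<lambda>\<epsilon>. r \<epsilon> * s \<epsilon>) (\<lambda>\<epsilon>. r' \<epsilon> * s' \<epsilon>)"
    using * by (simp add: net_rel_def moderate_mult)
qed

instance
proof
  fix a b c :: "'a colombeau"
  show "a + b + c = a + (b + c)"
    by transfer (simp add: net_rel_def moderate_add negligible_net_zero add.assoc)
  show "a + b = b + a"
    by transfer (simp add: net_rel_def moderate_add negligible_net_zero add.commute)
  show "0 + a = a"
    by transfer (simp add: net_rel_def negligible_net_zero)
  show "- a + a = 0"
    by transfer (simp add: net_rel_def moderate_const negligible_net_zero)
  show "a - b = a + - b"
    by transfer (simp add: net_rel_def moderate_diff negligible_net_zero)
  show "a * b * c = a * (b * c)"
    by transfer (simp add: net_rel_def moderate_mult negligible_net_zero mult.assoc)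
  show "a * b = b * a"
    by transfer (simp add: net_rel_def moderate_mult negligible_net_zero mult.commute)
  show "1 * a = a"
    by transfer (simp add: net_rel_def negligible_net_zero)
  show "(a + b) * c = a * c + b * c"
    by transfer (simp add: net_rel_def moderate_mult moderate_add negligible_net_zero distrib_right)
  show "(0::'a colombeau) \<noteq> 1"
    using not_negligible_net_one[where 'a = 'a] negligible_net_uminus[of "\<lambda>\<epsilon>. 1 :: 'a"]
    by transfer (simp add: net_rel_def)
qed

end

instantiation colombeau :: ("{real_normed_field, ord}") ord
begin

definition less_eq_colombeau :: "'a colombeau \<Rightarrow> 'a colombeau \<Rightarrow> bool" where
  "x \<le> y \<longleftrightarrow> (\<exists>r s. represents r x \<and> represents s y \<and> (\<forall>\<epsilon>\<in>{0<..1}. r \<epsilon> \<le> s \<epsilon>))"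

definition less_colombeau :: "'a colombeau \<Rightarrow> 'a colombeau \<Rightarrow> bool" where
  "x < y \<longleftrightarrow> x \<le> y \<and> \<not> y \<le> (x :: 'a colombeau)"

instance ..

end

definition nondegenerate :: "nat \<Rightarrow> real colombeau mat \<Rightarrow> bool" where
  "nondegenerate n A \<longleftrightarrow>
    (\<forall>x\<in>carrier_vec n. (\<forall>y\<in>carrier_vec n. x \<bullet> (A *\<^sub>v y) = 0) \<longrightarrow> x = 0\<^sub>v n)"

definition mat_represents ::
    "nat \<Rightarrow> (real \<Rightarrow> 'a::real_normed_field mat) \<Rightarrow> 'a colombeau mat \<Rightarrow> bool" where
  "mat_represents n M A \<longleftrightarrow>
    (\<forall>\<epsilon>\<in>{0<..1}. M \<epsilon> \<in> carrier_mat n n) \<and>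
    (\<forall>i<n. \<forall>j<n. represents (\<lambda>\<epsilon>. M \<epsilon> $$ (i, j)) (A $$ (i, j)))"

definition ordered_eigenvalues :: "real mat \<Rightarrow> complex list \<Rightarrow> bool" where
  "ordered_eigenvalues M es \<longleftrightarrow>
    char_poly (map_mat complex_of_real M) = (\<Prod>a\<leftarrow>es. [:- a, 1:]) \<and>
    sorted_wrt (\<lambda>a b. Im a \<ge> Im b) es"

text \<open>
  The representative \<open>M\<close> below is arbitrary; in particular the matrices \<open>M \<epsilon>\<close> need not be
  skew-symmetric. Where they are not, eigenvalues with equal imaginary part may be listed in
  any order.
\<close>

definition distinguished_tuple ::
    "nat \<Rightarrow> real colombeau mat \<Rightarrow> complex colombeau list \<Rightarrow> bool" where
  "distinguished_tuple n A \<theta>s \<longleftrightarrow> length \<theta>s = n \<and>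
    (\<exists>M es. mat_represents n M A \<and>
      (\<forall>\<epsilon>\<in>{0<..1}. ordered_eigenvalues (M \<epsilon>) (es \<epsilon>)) \<and>
      (\<forall>k<n. represents (\<lambda>\<epsilon>. es \<epsilon> ! k) (\<theta>s ! k)))"

text \<open>The bound makes nets of eigenvalues moderate, so every matrix has a distinguished tuple.\<close>

lemma represents_rep: "represents (rep_colombeau x) x"
  using Quotient_rep_reflp[OF Quotient_colombeau, of x] Quotient_abs_rep[OF Quotient_colombeau, of x]
  by (simp add: represents_def net_rel_def)

lemma eigenvalue_norm_le:
  fixes M :: "complex mat"
  assumes M: "M \<in> carrier_mat n n" and "eigenvalue M a"
  shows "norm a \<le> (\<Sum>i<n. \<Sum>j<n. norm (M $$ (i, j)))"
proof -
  obtain v where v: "v \<in> carrier_vec n" "v \<noteq> 0\<^sub>v n" "M *\<^sub>v v = a \<cdot>\<^sub>v v"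
    using assms unfolding eigenvalue_def eigenvector_def by auto
  have n: "n > 0"
    using v(1,2) by (cases n) auto
  define m where "m = Max ((\<lambda>i. norm (v $ i)) ` {..<n})"
  have "m \<in> (\<lambda>i. norm (v $ i)) ` {..<n}"
    unfolding m_def using n by (intro Max_in) auto
  then obtain i where i: "i < n" "m = norm (v $ i)" by auto
  have le: "norm (v $ j) \<le> m" if "j < n" for j
    unfolding m_def using that by (intro Max_ge) auto
  have "m > 0"
  proof (rule ccontr)
    assume "\<not> m > 0"
    then have "v $ j = 0" if "j < n" for j
      using le[OF that] by (simp add: not_less) (metis norm_le_zero_iff order_trans)
    then have "v = 0\<^sub>v n" using v(1) by (intro eq_vecI) auto
    then show False using v(2) by simp
  qed
  have "a * v $ i = (M *\<^sub>v v) $ i" using v(1,3) i(1) by simp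
  also have "\<dots> = (\<Sum>j<n. M $$ (i, j) * v $ j)"
    using M v(1) i(1) by (simp add: scalar_prod_def lessThan_atLeast0)
  finally have "norm a * m = norm (\<Sum>j<n. M $$ (i, j) * v $ j)"
    using i(2) by (metis norm_mult)
  also have "\<dots> \<le> (\<Sum>j<n. norm (M $$ (i, j)) * m)"
    by (rule sum_norm_le) (auto simp: norm_mult intro!: mult_left_mono le)
  also have "\<dots> = (\<Sum>j<n. norm (M $$ (i, j))) * m" by (simp add: sum_distrib_right)
  finally have "norm a \<le> (\<Sum>j<n. norm (M $$ (i, j)))" using \<open>m > 0\<close> by simp
  also have "\<dots> \<le> (\<Sum>i<n. \<Sum>j<n. norm (M $$ (i, j)))"
    using i(1) by (intro member_le_sum) (auto intro: sum_nonneg)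
  finally show ?thesis .
qed

lemma ordered_eigenvalues_exists:
  assumes M: "M \<in> carrier_mat n n"
  shows "\<exists>es. ordered_eigenvalues M es"
proof -
  have "map_mat complex_of_real M \<in> carrier_mat n n" using M by simp
  from char_poly_factorized[OF this] obtain as
    where as: "char_poly (map_mat complex_of_real M) = (\<Prod>a\<leftarrow>as. [:- a, 1:])" by blast
  define es where "es = sort_key (\<lambda>a. - Im a) as"
  have "mset (map (\<lambda>a. [:- a, 1:]) es) = mset (map (\<lambda>a. [:- a, 1:]) as)"
    by (simp add: es_def)
  then have "(\<Prod>a\<leftarrow>es. [:- a, 1:]) = (\<Prod>a\<leftarrow>as. [:- a, 1:])"
    by (metis prod_mset_prod_list)
  moreover have "sorted_wrt (\<lambda>a b. Im a \<ge> Im b) es"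
    using sorted_sort_key[of "\<lambda>a. - Im a" as] by (simp add: es_def sorted_map)
  ultimately show ?thesis using as unfolding ordered_eigenvalues_def by (intro exI[of _ es]) simp
qed

lemma ordered_eigenvalues_length:
  assumes "M \<in> carrier_mat n n" "ordered_eigenvalues M es"
  shows "length es = n"
proof -
  have "degree (\<Prod>a\<leftarrow>es. [:- a, 1:]) = length es"
    by (rule degree_linear_factors)
  moreover have "degree (char_poly (map_mat complex_of_real M)) = n"
    using assms(1) by (intro degree_monic_char_poly[THEN conjunct1]) simp
  ultimately show ?thesis using assms(2) by (simp add: ordered_eigenvalues_def)
qed

lemma distinguished_tuple_exists: "\<exists>\<theta>s. distinguished_tuple n A \<theta>s"
proof -
  define M where "M \<epsilon> = mat n n (\<lambda>(i, j). rep_colombeau (A $$ (i, j)) \<epsilon>)" for \<epsilon>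
  have M: "M \<epsilon> \<in> carrier_mat n n" for \<epsilon> by (simp add: M_def)
  obtain es where es: "\<And>\<epsilon>. ordered_eigenvalues (M \<epsilon>) (es \<epsilon>)"
    using ordered_eigenvalues_exists[OF M] by metis
  have rep: "mat_represents n M A"
    by (simp add: mat_represents_def M_def represents_rep)
  have "moderate (\<lambda>\<epsilon>. es \<epsilon> ! k)" if k: "k < n" for k
  proof (rule moderate_norm_le)
    have sum: "moderate (\<lambda>\<epsilon>. \<Sum>i<m. f i \<epsilon>)" if "\<And>i. i < m \<Longrightarrow> moderate (f i)"
      for m :: nat and f :: "nat \<Rightarrow> real \<Rightarrow> real"
      using that by (induction m) (auto simp: moderate_const intro: moderate_add)
    show "moderate (\<lambda>\<epsilon>. \<Sum>i<n. \<Sum>j<n. norm (M \<epsilon> $$ (i, j)))"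
    proof (intro sum)
      fix i j assume "i < n" "j < n"
      then have "moderate (\<lambda>\<epsilon>. M \<epsilon> $$ (i, j))"
        using rep by (auto simp: mat_represents_def represents_def)
      then show "moderate (\<lambda>\<epsilon>. norm (M \<epsilon> $$ (i, j)))"
        by (simp add: moderate_def)
    qed
    show "eventually (\<lambda>\<epsilon>. norm (es \<epsilon> ! k) \<le> norm (\<Sum>i<n. \<Sum>j<n. norm (M \<epsilon> $$ (i, j)))) (at_right 0)"
    proof (rule always_eventually, rule allI)
      fix \<epsilon>
      let ?M = "map_mat complex_of_real (M \<epsilon>)"
      have "es \<epsilon> ! k \<in> set (es \<epsilon>)"
        using k ordered_eigenvalues_length[OF M es] by simp
      then have "poly (char_poly ?M) (es \<epsilon> ! k) = 0"
        using es[of \<epsilon>] by (auto simp: ordered_eigenvalues_def poly_prod_list prod_list_zero_iff)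
      then have "eigenvalue ?M (es \<epsilon> ! k)"
        using M by (subst eigenvalue_root_char_poly[of _ n]) auto
      then have "norm (es \<epsilon> ! k) \<le> (\<Sum>i<n. \<Sum>j<n. norm (?M $$ (i, j)))"
        using M by (intro eigenvalue_norm_le) auto
      also have "\<dots> = (\<Sum>i<n. \<Sum>j<n. norm (M \<epsilon> $$ (i, j)))"
        using M[of \<epsilon>] by (intro sum.cong) auto
      finally show "norm (es \<epsilon> ! k) \<le> norm (\<Sum>i<n. \<Sum>j<n. norm (M \<epsilon> $$ (i, j)))"
        by simp
    qed
  qed
  then have "distinguished_tuple n A (map (\<lambda>k. abs_colombeau (\<lambda>\<epsilon>. es \<epsilon> ! k)) [0..<n])"
    unfolding distinguished_tuple_def using rep es by (auto simp: represents_def)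
  then show ?thesis ..
qed

definition rotation_block :: "real colombeau \<Rightarrow> real colombeau mat" where
  "rotation_block l = mat_of_rows_list 2 [[0, - l], [l, 0]]"

end

theory Submission
  imports Defs
begin

text \<open>
  A skew-symmetric \<open>A\<close> has a representative consisting of skew-symmetric real matrices, and each of
  these is orthogonally congruent to a matrix of rotation blocks with decreasing \<open>\<lambda>\<^sub>j \<ge> 0\<close>. Entries of
  orthogonal matrices are bounded, so the orthogonal matrices form a moderate net, and (i) holds with
  the classes of the \<open>\<lambda>\<^sub>j\<close>. It remains to see that an arbitrary representative of \<open>A\<close> leads to the
  same eigenvalues: both families factor the characteristic polynomial over the generalized complex
  numbers. Matching, for each \<open>\<epsilon>\<close>, a root of one factorization with the closest root of the other shows
  that the two families agree up to an \<open>\<epsilon>\<close>-dependent permutation and a negligible error, and sorting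
  by imaginary part does not increase the error.

  For (ii), a non-invertible generalized number is annihilated by some \<open>c \<noteq> 0\<close>, so a non-invertible
  \<open>\<theta>\<^sub>k\<close> makes \<open>c\<close> times a column of \<open>V\<close> a nonzero element of the kernel of \<open>A\<close>. If all \<open>\<theta>\<^sub>k\<close> are
  invertible, rescaling the columns of \<open>V\<close> by \<open>1 / sqrt \<lambda>\<^sub>j\<close> and reordering them gives the symplectic
  form, whose determinant is a unit; hence so are the determinants of \<open>A\<close> and of the new \<open>V\<close>.
\<close>

section \<open>Real skew-symmetric matrices\<close>

text \<open>The blocks are indexed by a function on the naturals, so that shifting its argument
  removes the first block. Values at \<open>q\<close> with \<open>n div 2 \<le> q\<close> never
  enter. For odd \<open>n\<close> the last row and column vanish, because the partner index
  \<open>n\<close> is out of range.\<close>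

definition skew_diag :: "nat \<Rightarrow> (nat \<Rightarrow> 'a) \<Rightarrow> 'a::comm_ring_1 mat" where
  "skew_diag n l = mat n n (\<lambda>(i, j).
     if even i \<and> j = Suc i then - l (i div 2)
     else if even j \<and> i = Suc j then l (j div 2) else 0)"

lemma skew_diag_carrier [simp]: "skew_diag n l \<in> carrier_mat n n"
  by (simp add: skew_diag_def)

lemma dim_skew_diag [simp]: "dim_row (skew_diag n l) = n" "dim_col (skew_diag n l) = n"
  by (simp_all add: skew_diag_def)

lemma index_skew_diag [simp]:
  "i < n \<Longrightarrow> j < n \<Longrightarrow> skew_diag n l $$ (i, j) =
     (if even i \<and> j = Suc i then - l (i div 2)
      else if even j \<and> i = Suc j then l (j div 2) else 0)"
  by (simp add: skew_diag_def)

lemma skew_diag_Suc_Suc: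
  "skew_diag (Suc (Suc n)) l =
     four_block_mat (skew_diag 2 (\<lambda>_. l 0)) (0\<^sub>m 2 n) (0\<^sub>m n 2) (skew_diag n (\<lambda>q. l (Suc q)))"
proof (rule eq_matI)
  fix i j
  assume "i < dim_row (four_block_mat (skew_diag 2 (\<lambda>_. l 0)) (0\<^sub>m 2 n) (0\<^sub>m n 2) (skew_diag n (\<lambda>q. l (Suc q))))"
    and "j < dim_col (four_block_mat (skew_diag 2 (\<lambda>_. l 0)) (0\<^sub>m 2 n) (0\<^sub>m n 2) (skew_diag n (\<lambda>q. l (Suc q))))"
  then have i: "i < Suc (Suc n)" and j: "j < Suc (Suc n)" by auto
  have "i = 0 \<or> i = 1 \<or> (\<exists>i'. i = Suc (Suc i'))" "j = 0 \<or> j = 1 \<or> (\<exists>j'. j = Suc (Suc j'))"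
    by presburger+
  then show "skew_diag (Suc (Suc n)) l $$ (i, j) =
     four_block_mat (skew_diag 2 (\<lambda>_. l 0)) (0\<^sub>m 2 n) (0\<^sub>m n 2) (skew_diag n (\<lambda>q. l (Suc q))) $$ (i, j)"
    using i j by (elim disjE exE) auto
qed auto

section \<open>Characteristic polynomials of block-diagonal forms\<close>

lemma char_poly_block_diag:
  fixes B :: "'a::idom mat"
  assumes B: "B \<in> carrier_mat m m" and D: "D \<in> carrier_mat n n"
  shows "char_poly (four_block_mat B (0\<^sub>m m n) (0\<^sub>m n m) D) = char_poly B * char_poly D"
proof -
  have "char_poly_matrix (four_block_mat B (0\<^sub>m m n) (0\<^sub>m n m) D) =
      four_block_mat (char_poly_matrix B) (0\<^sub>m m n) (0\<^sub>m n m) (char_poly_matrix D)"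
    using B D by (intro eq_matI) (auto simp: char_poly_matrix_def)
  then show ?thesis
    unfolding char_poly_def
    using det_four_block_mat_lower_left_zero[of "char_poly_matrix B" m "0\<^sub>m m n" n "0\<^sub>m n m" "char_poly_matrix D"] B D
    by simp
qed

lemma char_poly_skew_diag_2: "char_poly (skew_diag 2 l) = [:l 0 ^ 2, 0, 1:]"
proof -
  let ?M = "char_poly_matrix (skew_diag 2 l)"
  have M: "?M \<in> carrier_mat 2 2" by simp
  have entries: "?M $$ (0, 0) = [:0, 1:]" "?M $$ (1, 0) = [:- l 0:]"
    "?M $$ (0, 1) = [:l 0:]" "?M $$ (1, 1) = [:0, 1:]"
    by (auto simp: char_poly_matrix_def)
  have det1: "det (mat_delete ?M i 0) = mat_delete ?M i 0 $$ (0, 0)" for i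
    using mat_delete_carrier[OF M, of i 0] by (intro det_single) simp
  have c0: "cofactor ?M 0 0 = ?M $$ (1, 1)" and c1: "cofactor ?M 1 0 = - (?M $$ (0, 1))"
    unfolding cofactor_def det1 using carrier_matD[OF M] by (simp_all add: mat_delete_def)
  have "det ?M = (\<Sum>i<2. ?M $$ (i, 0) * cofactor ?M i 0)"
    by (rule laplace_expansion_column[OF M]) simp
  also have "\<dots> = ?M $$ (0, 0) * cofactor ?M 0 0 + ?M $$ (1, 0) * cofactor ?M 1 0"
    by (simp add: numeral_2_eq_2)
  also have "\<dots> = [:l 0 ^ 2, 0, 1:]"
    unfolding c0 c1 entries by (simp add: power2_eq_square)
  finally show ?thesis by (simp add: char_poly_def)
qed

text \<open>A two-step induction peels off one rotation block at a time; for odd \<open>n\<close>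
  the remaining zero block of size 1 contributes the factor X. The roots are read off later as plus
  and minus i times \<open>l q\<close>.\<close>

lemma char_poly_skew_diag:
  fixes l :: "nat \<Rightarrow> 'a::idom"
  shows "char_poly (skew_diag n l) = (\<Prod>q<n div 2. [:l q ^ 2, 0, 1:]) * [:0, 1:] ^ (n mod 2)"
proof (induction n arbitrary: l rule: induct_nat_012)
  case 0
  then show ?case by (simp add: char_poly_def)
next
  case 1
  have "det (char_poly_matrix (skew_diag (Suc 0) l)) = char_poly_matrix (skew_diag (Suc 0) l) $$ (0, 0)"
    by (rule det_single) (simp add: char_poly_matrix_def carrier_matI)
  then show ?case by (simp add: char_poly_def char_poly_matrix_def)
next
  case (ge2 n)
  show ?case
    unfolding skew_diag_Suc_Suc
    by (subst char_poly_block_diag)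
       (simp_all add: ge2 char_poly_skew_diag_2 prod.lessThan_Suc_shift mult.assoc
         del: prod.lessThan_Suc mult_pCons_left)
qed

section \<open>Eigenvectors of real skew-symmetric matrices\<close>

lemma skew_scalar_prod:
  fixes A :: "'a::comm_ring_1 mat"
  assumes A: "A \<in> carrier_mat n n" and skew: "transpose_mat A = - A"
    and x: "x \<in> carrier_vec n" and y: "y \<in> carrier_vec n"
  shows "x \<bullet> (A *\<^sub>v y) = - (y \<bullet> (A *\<^sub>v x))"
proof -
  have "x \<bullet> (A *\<^sub>v y) = (transpose_mat A *\<^sub>v x) \<bullet> y"
    using transpose_vec_mult_scalar[OF A y x] by simp
  also have "\<dots> = - ((A *\<^sub>v x) \<bullet> y)"
    unfolding skew using A x y by (simp add: scalar_prod_def sum_negf)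
  also have "(A *\<^sub>v x) \<bullet> y = y \<bullet> (A *\<^sub>v x)"
    using A x y by (intro comm_scalar_prod) auto
  finally show ?thesis .
qed

lemma scalar_prod_self_eq_0_iff:
  fixes x :: "real vec"
  assumes "x \<in> carrier_vec n"
  shows "x \<bullet> x = 0 \<longleftrightarrow> x = 0\<^sub>v n"
proof
  assume "x \<bullet> x = 0"
  then have "\<forall>i\<in>{0..<n}. x $ i * x $ i = 0"
    using assms by (subst sum_nonneg_eq_0_iff[symmetric]) (auto simp: scalar_prod_def)
  then show "x = 0\<^sub>v n" using assms by (intro eq_vecI) auto
qed simp

lemma zero_smult_vec: "0 \<cdot>\<^sub>v (v :: 'a::mult_zero vec) = 0\<^sub>v (dim_vec v)"
  by (rule eq_vecI) auto

lemma scalar_prod_self_nonneg: "(x :: real vec) \<bullet> x \<ge> 0"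
  by (simp add: scalar_prod_def sum_nonneg)

text \<open>\<open>x\<close> and \<open>y\<close> are the real and imaginary parts of a complex eigenvector for \<open>z\<close>.\<close>

lemma real_skew_eigenpair:
  fixes S :: "real mat"
  assumes S: "S \<in> carrier_mat n n" and skew: "transpose_mat S = - S"
    and root: "poly (map_poly complex_of_real (char_poly S)) z = 0"
  obtains x y where "Re z = 0" "x \<in> carrier_vec n" "y \<in> carrier_vec n"
    "x \<noteq> 0\<^sub>v n \<or> y \<noteq> 0\<^sub>v n" "S *\<^sub>v x = (- Im z) \<cdot>\<^sub>v y" "S *\<^sub>v y = Im z \<cdot>\<^sub>v x"
proof -
  let ?S = "map_mat complex_of_real S"
  have "eigenvalue ?S z"
    using root S by (subst eigenvalue_root_char_poly[of _ n]) (auto simp: of_real_hom.char_poly_hom[OF S])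
  then obtain v where v: "v \<in> carrier_vec n" "v \<noteq> 0\<^sub>v n" "?S *\<^sub>v v = z \<cdot>\<^sub>v v"
    using S unfolding eigenvalue_def eigenvector_def by auto
  define x where "x = map_vec Re v"
  define y where "y = map_vec Im v"
  have x: "x \<in> carrier_vec n" and y: "y \<in> carrier_vec n" using v by (auto simp: x_def y_def)
  have ne: "x \<noteq> 0\<^sub>v n \<or> y \<noteq> 0\<^sub>v n"
  proof (rule ccontr)
    assume "\<not> ?thesis"
    then have "Re (v $ i) = 0" "Im (v $ i) = 0" if "i < n" for i
      using that v(1) by (auto simp: x_def y_def vec_eq_iff)
    then have "v = 0\<^sub>v n" using v(1) by (intro eq_vecI) (auto simp: complex_eq_iff)
    with v(2) show False by simp
  qed
  have eq: "(\<Sum>j<n. complex_of_real (S $$ (i, j)) * v $ j) = z * v $ i" if i: "i < n" for i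
    using arg_cong[OF v(3), of "\<lambda>w. w $ i"] i v(1) S
    by (simp add: scalar_prod_def lessThan_atLeast0)
  have Sx: "S *\<^sub>v x = Re z \<cdot>\<^sub>v x - Im z \<cdot>\<^sub>v y"
  proof (rule eq_vecI)
    fix i assume "i < dim_vec (Re z \<cdot>\<^sub>v x - Im z \<cdot>\<^sub>v y)"
    then have "i < n" using y by simp
    then show "(S *\<^sub>v x) $ i = (Re z \<cdot>\<^sub>v x - Im z \<cdot>\<^sub>v y) $ i"
      using arg_cong[OF eq[of i], of Re] v(1) S
      by (simp add: scalar_prod_def lessThan_atLeast0 x_def y_def)
  qed (use S y in auto)
  have Sy: "S *\<^sub>v y = Im z \<cdot>\<^sub>v x + Re z \<cdot>\<^sub>v y"
  proof (rule eq_vecI)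
    fix i assume "i < dim_vec (Im z \<cdot>\<^sub>v x + Re z \<cdot>\<^sub>v y)"
    then have "i < n" using y by simp
    then show "(S *\<^sub>v y) $ i = (Im z \<cdot>\<^sub>v x + Re z \<cdot>\<^sub>v y) $ i"
      using arg_cong[OF eq[of i], of Im] v(1) S
      by (simp add: scalar_prod_def lessThan_atLeast0 x_def y_def algebra_simps)
  qed (use S y in auto)
  \<comment> \<open>Skewness makes both quadratic forms vanish. Their sum is \<open>Re z\<close>
    times the squared length of the eigenvector, so the eigenvalue is purely imaginary.\<close>
  have "x \<bullet> (S *\<^sub>v x) = 0" "y \<bullet> (S *\<^sub>v y) = 0"
    using skew_scalar_prod[OF S skew x x] skew_scalar_prod[OF S skew y y] by auto
  then have "Re z * (x \<bullet> x) - Im z * (x \<bullet> y) = 0" "Im z * (y \<bullet> x) + Re z * (y \<bullet> y) = 0"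
    unfolding Sx Sy using x y
    by (simp_all add: scalar_prod_minus_distrib[of _ n] scalar_prod_add_distrib[of _ n])
  moreover have "y \<bullet> x = x \<bullet> y" by (rule comm_scalar_prod[OF y x])
  ultimately have "Re z * (x \<bullet> x + y \<bullet> y) = 0" by (simp add: algebra_simps)
  moreover have "x \<bullet> x + y \<bullet> y \<noteq> 0"
    using ne scalar_prod_self_nonneg[of x] scalar_prod_self_nonneg[of y]
      scalar_prod_self_eq_0_iff[OF x] scalar_prod_self_eq_0_iff[OF y] by (auto simp: add_nonneg_eq_0_iff)
  ultimately have re: "Re z = 0" by simp
  have "S *\<^sub>v x = (- Im z) \<cdot>\<^sub>v y" "S *\<^sub>v y = Im z \<cdot>\<^sub>v x"
    unfolding Sx Sy re using carrier_vecD[OF x] carrier_vecD[OF y] by (intro eq_vecI; simp)+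
  with re x y ne show thesis by (intro that) auto
qed

section \<open>Orthogonal matrices with prescribed first columns\<close>

lemma orthogonal_mat_with_first_col:
  fixes u :: "real vec"
  assumes u: "u \<in> carrier_vec (Suc n)" and unit: "u \<bullet> u = 1"
  obtains W where "W \<in> carrier_mat (Suc n) (Suc n)" "transpose_mat W * W = 1\<^sub>m (Suc n)" "col W 0 = u"
proof -
  \<comment> \<open>The Householder reflection exchanging \<open>e\<^sub>0\<close> and \<open>u\<close>; for \<open>u = e\<^sub>0\<close>, division by zero makes
    \<open>c = 0\<close> and hence \<open>W\<close> the identity.\<close>
  define w where "w i = (if i = 0 then 1 else 0) - u $ i" for i
  define c where "c = 1 / (1 - u $ 0)"
  define W where "W = mat (Suc n) (Suc n) (\<lambda>(i, j). (if i = j then 1 else 0) - c * w i * w j)"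
  have sumu: "(\<Sum>i<Suc n. u $ i * u $ i) = 1"
    using unit u by (simp add: scalar_prod_def lessThan_atLeast0)
  \<comment> \<open>This identifies \<open>c\<close> as 2 divided by the squared length of
    \<open>w\<close>, the coefficient that turns the matrix into a reflection when \<open>w\<close>
    is nonzero.\<close>
  have sumw: "(\<Sum>i<Suc n. w i * w i) = 2 * (1 - u $ 0)"
  proof -
    have "(\<Sum>i<Suc n. w i * w i) = (\<Sum>i<Suc n. (if i = 0 then 1 - 2 * u $ 0 else 0) + u $ i * u $ i)"
      by (rule sum.cong) (auto simp: w_def algebra_simps)
    also have "\<dots> = 2 * (1 - u $ 0)"
      unfolding sum.distrib sumu by (simp add: sum.delta)
    finally show ?thesis .
  qed
  have W: "W \<in> carrier_mat (Suc n) (Suc n)" by (simp add: W_def)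
  have cc: "c * c * (2 * (1 - u $ 0)) * x = 2 * c * x" for x
  proof (cases "u $ 0 = 1")
    case False
    then have "c * (1 - u $ 0) = 1" by (simp add: c_def)
    moreover have "c * c * (2 * (1 - u $ 0)) * x = 2 * c * x * (c * (1 - u $ 0))" by simp
    ultimately show ?thesis by simp
  qed (simp add: c_def)
  \<comment> \<open>In the exceptional case the squared length of \<open>w\<close> is 0, so
    \<open>u\<close> is the first unit vector and agrees with the first column of the
    identity.\<close>
  have "u $ i = 0" if "u $ 0 = 1" "i < Suc n" "i \<noteq> 0" for i
  proof -
    have "\<forall>i\<in>{..<Suc n}. w i * w i = 0"
      using sumw that(1) by (subst sum_nonneg_eq_0_iff[symmetric]) auto
    then have "w i * w i = 0" using that(2) by blast
    then show ?thesis using that(3) by (simp add: w_def)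
  qed
  then have "col W 0 = u"
    using u by (cases "u $ 0 = 1"; intro eq_vecI) (auto simp: W_def c_def w_def)
  moreover have "transpose_mat W * W = 1\<^sub>m (Suc n)"
  proof (rule eq_matI)
    fix i j assume "i < dim_row (1\<^sub>m (Suc n) :: real mat)" "j < dim_col (1\<^sub>m (Suc n) :: real mat)"
    then have i: "i < Suc n" and j: "j < Suc n" by auto
    have "(transpose_mat W * W) $$ (i, j) =
        (\<Sum>k<Suc n. ((if k = i then 1 else 0) - c * w k * w i) * ((if k = j then 1 else 0) - c * w k * w j))"
      using i j by (simp add: W_def scalar_prod_def lessThan_atLeast0 del: sum.lessThan_Suc sum.atLeast0_lessThan_Suc)
    also have "\<dots> = (\<Sum>k<Suc n. (if k = i then (if i = j then 1 else 0) - c * w i * w j else 0) +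
        (if k = j then - c * w i * w j else 0) + c * c * w i * w j * (w k * w k))"
      by (rule sum.cong) (auto simp: algebra_simps)
    also have "\<dots> = (if i = j then 1 else 0) - 2 * c * w i * w j
        + c * c * w i * w j * (\<Sum>k<Suc n. w k * w k)"
      unfolding sum.distrib sum_distrib_left[symmetric] using i j
      by (simp del: sum.lessThan_Suc)
    also have "\<dots> = (if i = j then 1 else 0)"
      unfolding sumw using cc[of "w i * w j"] by (simp add: mult_ac)
    finally show "(transpose_mat W * W) $$ (i, j) = 1\<^sub>m (Suc n) $$ (i, j)" using i j by simp
  qed (simp_all add: W_def)
  ultimately show thesis using W that by blast
qed

lemma orthogonal_block_mat:
  fixes V :: "'a::comm_ring_1 mat" and m :: nat
  assumes V: "V \<in> carrier_mat n n" "transpose_mat V * V = 1\<^sub>m n"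
  defines "U \<equiv> four_block_mat (1\<^sub>m m) (0\<^sub>m m n) (0\<^sub>m n m) V"
  shows "U \<in> carrier_mat (m + n) (m + n)" "transpose_mat U * U = 1\<^sub>m (m + n)"
proof -
  show "U \<in> carrier_mat (m + n) (m + n)" using V by (simp add: U_def)
  have "transpose_mat U = four_block_mat (1\<^sub>m m) (0\<^sub>m m n) (0\<^sub>m n m) (transpose_mat V)"
    unfolding U_def using V by (subst transpose_four_block_mat[of _ m m _ n _ n]) auto
  then show "transpose_mat U * U = 1\<^sub>m (m + n)"
    unfolding U_def using V by (simp add: mult_four_block_mat[of _ m m _ n _ n _ _ m _ n])
qed

lemma orthogonal_mult:
  fixes V W :: "'a::comm_ring_1 mat"
  assumes "W \<in> carrier_mat n n" "V \<in> carrier_mat n n"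
    and "transpose_mat W * W = 1\<^sub>m n" "transpose_mat V * V = 1\<^sub>m n"
  shows "transpose_mat (W * V) * (W * V) = 1\<^sub>m n"
proof -
  have "transpose_mat (W * V) * (W * V) = transpose_mat V * (transpose_mat W * W) * V"
    using assms(1,2) by (simp add: transpose_mult[of _ n n _ n] assoc_mult_mat[of _ n n _ n _ n])
  then show ?thesis using assms by simp
qed

text \<open>A first orthogonal matrix \<open>W\<close> takes the first unit vector to
  \<open>u\<close>. In the coordinates of \<open>W\<close> the vector \<open>v\<close> has first
  entry 0, so a second orthogonal matrix, acting on the other coordinates only, can take the second
  unit vector to it without moving the first one.\<close>

lemma orthogonal_mat_with_two_cols:
  fixes u v :: "real vec"
  assumes u: "u \<in> carrier_vec (Suc (Suc n))" "u \<bullet> u = 1"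
    and v: "v \<in> carrier_vec (Suc (Suc n))" "v \<bullet> v = 1" and uv: "u \<bullet> v = 0"
  obtains W where "W \<in> carrier_mat (Suc (Suc n)) (Suc (Suc n))"
    "transpose_mat W * W = 1\<^sub>m (Suc (Suc n))" "col W 0 = u" "col W 1 = v"
proof -
  let ?n = "Suc (Suc n)"
  obtain W where W: "W \<in> carrier_mat ?n ?n" "transpose_mat W * W = 1\<^sub>m ?n" "col W 0 = u"
    using orthogonal_mat_with_first_col[OF u] by blast
  have W': "W * transpose_mat W = 1\<^sub>m ?n"
    by (rule mat_mult_left_right_inverse[OF _ W(1,2)]) (use W in auto)
  define t where "t = transpose_mat W *\<^sub>v v"
  have t: "t \<in> carrier_vec ?n" using W v by (simp add: t_def)
  have Wt: "W *\<^sub>v t = v"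
    unfolding t_def using assoc_mult_mat_vec[of W ?n ?n "transpose_mat W" ?n v] W(1) v(1) W' by auto
  have t0: "t $ 0 = 0"
    using W uv v by (simp add: t_def row_transpose)
  have tt: "t \<bullet> t = 1"
    using transpose_vec_mult_scalar[OF W(1) t v(1)] v(2) Wt by (simp add: t_def)
  define s where "s = vec (Suc n) (\<lambda>i. t $ Suc i)"
  have s: "s \<in> carrier_vec (Suc n)" by (simp add: s_def)
  have "t \<bullet> t = s \<bullet> s"
    using t t0 by (simp add: scalar_prod_def s_def sum.atLeast0_lessThan_Suc_shift
      del: sum.atLeast0_lessThan_Suc sum.op_ivl_Suc)
  with tt have "s \<bullet> s = 1" by simp
  from orthogonal_mat_with_first_col[OF s this] obtain Y where
    Y: "Y \<in> carrier_mat (Suc n) (Suc n)" "transpose_mat Y * Y = 1\<^sub>m (Suc n)" "col Y 0 = s" by blast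
  define U where "U = four_block_mat (1\<^sub>m 1) (0\<^sub>m 1 (Suc n)) (0\<^sub>m (Suc n) 1) Y"
  have U: "U \<in> carrier_mat ?n ?n" "transpose_mat U * U = 1\<^sub>m ?n"
    using orthogonal_block_mat[OF Y(1,2), of 1] by (simp_all add: U_def)
  have "col U 0 = unit_vec ?n 0"
    using Y(1) by (intro eq_vecI) (auto simp: U_def)
  then have "col (W * U) 0 = col (W * 1\<^sub>m ?n) 0"
    by (simp add: col_mult2[OF W(1) U(1)] col_mult2[OF W(1) one_carrier_mat])
  then have c0: "col (W * U) 0 = u"
    using W by simp
  have "col U 1 = t"
  proof (rule eq_vecI)
    fix i assume "i < dim_vec t"
    then have i: "i < ?n" using t by simp
    then have "s $ (i - 1) = t $ i" if "i > 0" using that by (cases i) (simp_all add: s_def)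
    with i show "col U 1 $ i = t $ i"
      using t0 Y(1) arg_cong[OF Y(3), of "\<lambda>x. x $ (i - 1)"] by (cases "i = 0") (auto simp: U_def)
  qed (use U t in auto)
  then have c1: "col (W * U) 1 = v"
    using Wt by (simp add: col_mult2[OF W(1) U(1)])
  show thesis
    by (rule that[of "W * U"]) (use W U c0 c1 orthogonal_mult in auto)
qed

section \<open>Congruence and block splitting\<close>

lemma skew_congruence:
  fixes A :: "'a::comm_ring_1 mat"
  assumes A: "A \<in> carrier_mat n n" "transpose_mat A = - A" and V: "V \<in> carrier_mat n m"
  shows "transpose_mat (transpose_mat V * A * V) = - (transpose_mat V * A * V)"
proof -
  have VA: "transpose_mat V * A \<in> carrier_mat m n" using A V by simp
  have "transpose_mat (transpose_mat V * A * V) = transpose_mat V * (- A * V)"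
    unfolding transpose_mult[OF VA V] using transpose_mult[of "transpose_mat V" m n A n] A V
    by simp
  also have "\<dots> = - (transpose_mat V * A * V)"
    using A V by (simp add: assoc_mult_mat[of _ m n _ n _ m] uminus_mult_left_mat uminus_mult_right_mat)
  finally show ?thesis .
qed

lemma congruence_mult:
  fixes S :: "'a::comm_ring_1 mat"
  assumes "S \<in> carrier_mat n n" "W \<in> carrier_mat n n" "U \<in> carrier_mat n n"
  shows "transpose_mat (W * U) * S * (W * U) = transpose_mat U * (transpose_mat W * S * W) * U"
  using assms by (simp add: transpose_mult[of W n n U n] assoc_mult_mat[of _ n n _ n _ n])

text \<open>The transpose of an orthogonal matrix is its inverse. Hence the reductions below
  preserve the characteristic polynomial.\<close>

lemma orthogonal_congruence_similar:
  fixes W :: "'a::field mat"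
  assumes S: "S \<in> carrier_mat n n" and W: "W \<in> carrier_mat n n" "transpose_mat W * W = 1\<^sub>m n"
  shows "similar_mat (transpose_mat W * S * W) S"
proof (rule similar_matI[of _ _ "transpose_mat W" W n])
  show "W * transpose_mat W = 1\<^sub>m n"
    by (rule mat_mult_left_right_inverse[OF _ W]) (use W in simp)
qed (use S W in auto)

text \<open>Skewness transports the zeros below the block \<open>B\<close> to the right of it, so
  knowing the first \<open>m\<close> columns suffices for a splitting.\<close>

lemma skew_block_diag:
  fixes T :: "'a::comm_ring_1 mat"
  assumes T: "T \<in> carrier_mat (m + n) (m + n)" "transpose_mat T = - T"
    and B: "B \<in> carrier_mat m m"
    and cols: "\<And>i j. i < m + n \<Longrightarrow> j < m \<Longrightarrow> T $$ (i, j) = (if i < m then B $$ (i, j) else 0)"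
  obtains S' where "S' \<in> carrier_mat n n" "transpose_mat S' = - S'"
    "T = four_block_mat B (0\<^sub>m m n) (0\<^sub>m n m) S'"
proof -
  define S' where "S' = mat n n (\<lambda>(i, j). T $$ (i + m, j + m))"
  have skew: "T $$ (j, i) = - (T $$ (i, j))" if "i < m + n" "j < m + n" for i j
    using arg_cong[OF T(2), of "\<lambda>M. M $$ (i, j)"] T(1) that by simp
  have S': "S' \<in> carrier_mat n n" by (simp add: S'_def)
  have "transpose_mat S' = - S'"
    by (rule eq_matI) (auto simp: S'_def intro!: skew)
  moreover have "T = four_block_mat B (0\<^sub>m m n) (0\<^sub>m n m) S'"
  proof (rule eq_matI)
    fix i j
    assume "i < dim_row (four_block_mat B (0\<^sub>m m n) (0\<^sub>m n m) S')"
      and "j < dim_col (four_block_mat B (0\<^sub>m m n) (0\<^sub>m n m) S')"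
    then have ij: "i < m + n" "j < m + n" using B S' by auto
    then show "T $$ (i, j) = four_block_mat B (0\<^sub>m m n) (0\<^sub>m n m) S' $$ (i, j)"
      using B S' cols[of i j] cols[of j i] skew[of j i] by (auto simp: S'_def)
  qed (use T B S' in auto)
  ultimately show thesis using S' that by blast
qed

lemma congruence_entries:
  fixes W S :: "'a::comm_ring_1 mat"
  assumes "W \<in> carrier_mat n m" "S \<in> carrier_mat n n" "i < m" "j < m"
  shows "(transpose_mat W * S * W) $$ (i, j) = col W i \<bullet> (S *\<^sub>v col W j)"
proof -
  have "transpose_mat W * S * W = transpose_mat W * (S * W)"
    using assms by (simp add: assoc_mult_mat[of _ m n _ n _ m])
  then show ?thesis using assms by (simp add: col_mult2[OF assms(2,1,4)] del: col_mult2)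
qed

section \<open>Splitting off a kernel vector or an invariant plane\<close>

lemma scalar_prod_normalized:
  fixes x :: "real vec"
  assumes "x \<in> carrier_vec n" "x \<noteq> 0\<^sub>v n"
  shows "((1 / sqrt (x \<bullet> x)) \<cdot>\<^sub>v x) \<bullet> ((1 / sqrt (x \<bullet> x)) \<cdot>\<^sub>v x) = 1"
proof -
  have "x \<bullet> x > 0"
    using scalar_prod_self_eq_0_iff[OF assms(1)] scalar_prod_self_nonneg[of x] assms(2) by linarith
  then show ?thesis using assms(1) by (simp add: field_simps)
qed

text \<open>With the normalized kernel vector as first basis vector, the first column of the
  transformed matrix vanishes, and by skewness so does the first row.\<close>

lemma real_skew_deflate_kernel:
  fixes S :: "real mat"
  assumes S: "S \<in> carrier_mat (Suc n) (Suc n)" "transpose_mat S = - S"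
    and x: "x \<in> carrier_vec (Suc n)" "x \<noteq> 0\<^sub>v (Suc n)" "S *\<^sub>v x = 0\<^sub>v (Suc n)"
  obtains W S' where "W \<in> carrier_mat (Suc n) (Suc n)" "transpose_mat W * W = 1\<^sub>m (Suc n)"
    "S' \<in> carrier_mat n n" "transpose_mat S' = - S'"
    "transpose_mat W * S * W = four_block_mat (0\<^sub>m 1 1) (0\<^sub>m 1 n) (0\<^sub>m n 1) S'"
proof -
  define u where "u = (1 / sqrt (x \<bullet> x)) \<cdot>\<^sub>v x"
  have u: "u \<in> carrier_vec (Suc n)" "u \<bullet> u = 1"
    using x scalar_prod_normalized[OF x(1,2)] by (auto simp: u_def)
  have Su: "S *\<^sub>v u = 0\<^sub>v (Suc n)"
    unfolding u_def by (subst mult_mat_vec[OF S(1) x(1)]) (auto simp: x(3))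
  obtain W where W: "W \<in> carrier_mat (Suc n) (Suc n)" "transpose_mat W * W = 1\<^sub>m (Suc n)" "col W 0 = u"
    using orthogonal_mat_with_first_col[OF u] by blast
  let ?T = "transpose_mat W * S * W"
  have T: "?T \<in> carrier_mat (1 + n) (1 + n)" using W S by simp
  have "?T $$ (i, j) = (if i < 1 then 0\<^sub>m 1 1 $$ (i, j) else 0)" if "i < 1 + n" "j < 1" for i j
  proof -
    have "?T $$ (i, j) = col W i \<bullet> (S *\<^sub>v u)"
      using that W S congruence_entries[of W "Suc n" "Suc n" S i j] by simp
    then show ?thesis using that W(1) by (auto simp: Su)
  qed
  then obtain S' where "S' \<in> carrier_mat n n" "transpose_mat S' = - S'"
    "?T = four_block_mat (0\<^sub>m 1 1) (0\<^sub>m 1 n) (0\<^sub>m n 1) S'"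
    using skew_block_diag[OF T skew_congruence[OF S W(1)] zero_carrier_mat] by blast
  then show thesis by (rule that[OF W(1,2)])
qed

lemma map_poly_of_real_mult:
  "map_poly (of_real :: real \<Rightarrow> 'a::{real_algebra_1,comm_ring_1}) (p * q) = map_poly of_real p * map_poly of_real q"
  by (simp add: poly_eq_iff coeff_map_poly coeff_mult)

text \<open>Supplies an eigenvalue off the real axis for every nonzero skew matrix. By the
  fundamental theorem of algebra there is a root; it is real by hypothesis and imaginary by
  skewness, hence 0. Splitting off a kernel vector leaves a smaller skew matrix whose characteristic
  polynomial divides that of \<open>S\<close>.\<close>

lemma real_skew_eq_0:
  fixes S :: "real mat"
  assumes "S \<in> carrier_mat n n" "transpose_mat S = - S"
    and "\<And>z. poly (map_poly complex_of_real (char_poly S)) z = 0 \<Longrightarrow> Im z = 0"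
  shows "S = 0\<^sub>m n n"
  using assms
proof (induction n arbitrary: S)
  case 0
  then show ?case by (intro eq_matI) auto
next
  case (Suc n)
  note S = Suc.prems(1,2)
  have "degree (map_poly complex_of_real (char_poly S)) = Suc n"
    using degree_monic_char_poly[OF S(1)] by simp
  then obtain z where z: "poly (map_poly complex_of_real (char_poly S)) z = 0"
    using fundamental_theorem_of_algebra[of "map_poly complex_of_real (char_poly S)"]
    by (auto simp: constant_degree)
  obtain x where x: "x \<in> carrier_vec (Suc n)" "x \<noteq> 0\<^sub>v (Suc n)" "S *\<^sub>v x = 0\<^sub>v (Suc n)"
    by (rule real_skew_eigenpair[OF S z]) (use Suc.prems(3)[OF z] in \<open>auto simp: zero_smult_vec\<close>)
  obtain W S' where W: "W \<in> carrier_mat (Suc n) (Suc n)" "transpose_mat W * W = 1\<^sub>m (Suc n)"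
    and S': "S' \<in> carrier_mat n n" "transpose_mat S' = - S'"
    and T: "transpose_mat W * S * W = four_block_mat (0\<^sub>m 1 1) (0\<^sub>m 1 n) (0\<^sub>m n 1) S'"
    by (rule real_skew_deflate_kernel[OF S x])
  have "char_poly S = char_poly (transpose_mat W * S * W)"
    by (rule char_poly_similar[symmetric, OF orthogonal_congruence_similar[OF S(1) W]])
  also have "\<dots> = char_poly (0\<^sub>m 1 1) * char_poly S'"
    unfolding T using S' by (intro char_poly_block_diag) auto
  finally have "map_poly complex_of_real (char_poly S) =
      map_poly of_real (char_poly (0\<^sub>m 1 1)) * map_poly of_real (char_poly S')"
    by (simp add: map_poly_of_real_mult)
  then have "S' = 0\<^sub>m n n"
    using S' Suc.prems(3) by (intro Suc.IH) simp_all
  then have T0: "transpose_mat W * S * W = 0\<^sub>m (Suc n) (Suc n)"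
    unfolding T by (auto intro!: eq_matI)
  have "W * transpose_mat W = 1\<^sub>m (Suc n)"
    by (rule mat_mult_left_right_inverse[OF _ W]) (use W in simp)
  then have "S = W * (transpose_mat W * S * W) * transpose_mat W"
    using S W by (simp add: assoc_mult_mat[of _ "Suc n" "Suc n" _ "Suc n" _ "Suc n"])
       (simp add: assoc_mult_mat[of _ "Suc n" "Suc n" _ "Suc n" _ "Suc n", symmetric])
  then show ?case unfolding T0 using W by simp
qed

text \<open>As \<open>b\<close> is nonzero, skewness forces \<open>x\<close> and \<open>y\<close> to
  be orthogonal and of equal length, so one factor normalizes both. Taking the multiple of
  \<open>y\<close> as first and that of \<open>x\<close> as second basis vector gives the rotation
  block the required sign.\<close>

lemma real_skew_deflate_plane:
  fixes S :: "real mat"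
  assumes S: "S \<in> carrier_mat (Suc (Suc n)) (Suc (Suc n))" "transpose_mat S = - S"
    and b: "b \<noteq> 0"
    and x: "x \<in> carrier_vec (Suc (Suc n))" and y: "y \<in> carrier_vec (Suc (Suc n))"
    and ne: "x \<noteq> 0\<^sub>v (Suc (Suc n)) \<or> y \<noteq> 0\<^sub>v (Suc (Suc n))"
    and Sx: "S *\<^sub>v x = (- b) \<cdot>\<^sub>v y" and Sy: "S *\<^sub>v y = b \<cdot>\<^sub>v x"
  obtains W S' where "W \<in> carrier_mat (Suc (Suc n)) (Suc (Suc n))"
    "transpose_mat W * W = 1\<^sub>m (Suc (Suc n))"
    "S' \<in> carrier_mat n n" "transpose_mat S' = - S'"
    "transpose_mat W * S * W = four_block_mat (skew_diag 2 (\<lambda>_. b)) (0\<^sub>m 2 n) (0\<^sub>m n 2) S'"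
proof -
  let ?n = "Suc (Suc n)"
  have yx: "y \<bullet> x = x \<bullet> y" by (rule comm_scalar_prod[OF y x])
  have "x \<bullet> (S *\<^sub>v x) = 0" using skew_scalar_prod[OF S x x] by simp
  then have xy: "x \<bullet> y = 0" unfolding Sx using b x y by simp
  have "x \<bullet> (S *\<^sub>v y) = - (y \<bullet> (S *\<^sub>v x))" by (rule skew_scalar_prod[OF S x y])
  then have xx: "x \<bullet> x = y \<bullet> y" unfolding Sx Sy using b x y by simp
  then have "x \<noteq> 0\<^sub>v ?n" "y \<noteq> 0\<^sub>v ?n"
    using ne scalar_prod_self_eq_0_iff[OF x] scalar_prod_self_eq_0_iff[OF y] by auto
  define c where "c = 1 / sqrt (x \<bullet> x)"
  define u where "u = c \<cdot>\<^sub>v y"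
  define v where "v = c \<cdot>\<^sub>v x"
  have u: "u \<in> carrier_vec ?n" "u \<bullet> u = 1"
    using y scalar_prod_normalized[OF y \<open>y \<noteq> _\<close>] by (auto simp: u_def c_def xx)
  have v: "v \<in> carrier_vec ?n" "v \<bullet> v = 1"
    using x scalar_prod_normalized[OF x \<open>x \<noteq> _\<close>] by (auto simp: v_def c_def)
  have uv: "u \<bullet> v = 0" "v \<bullet> u = 0" using x y xy yx by (simp_all add: u_def v_def)
  have Su: "S *\<^sub>v u = b \<cdot>\<^sub>v v" and Sv: "S *\<^sub>v v = (- b) \<cdot>\<^sub>v u"
    by (simp_all add: u_def v_def mult_mat_vec[OF S(1) x] mult_mat_vec[OF S(1) y] Sx Sy smult_smult_assoc mult.commute)
  obtain W where W: "W \<in> carrier_mat ?n ?n" "transpose_mat W * W = 1\<^sub>m ?n" "col W 0 = u" "col W 1 = v"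
    using orthogonal_mat_with_two_cols[OF u v uv(1)] by blast
  let ?T = "transpose_mat W * S * W"
  have T: "?T \<in> carrier_mat (2 + n) (2 + n)" using W S by simp
  have cc: "col W i \<bullet> col W j = (if i = j then 1 else 0)" if "i < ?n" "j < ?n" for i j
    using arg_cong[OF W(2), of "\<lambda>M. M $$ (i, j)"] that W(1) by (simp add: row_transpose)
  have "?T $$ (i, j) = (if i < 2 then skew_diag 2 (\<lambda>_. b) $$ (i, j) else 0)" if i: "i < 2 + n" and j: "j < 2" for i j
  proof -
    have T_ij: "?T $$ (i, j) = col W i \<bullet> (S *\<^sub>v col W j)"
      using i j W S by (intro congruence_entries[of _ ?n ?n]) auto
    have ci: "col W i \<in> carrier_vec ?n" using i W by auto
    consider "j = 0" | "j = 1" using j by linarith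
    then show ?thesis
    proof cases
      case 1
      have "?T $$ (i, 0) = b * (col W i \<bullet> col W 1)"
        using ci v(1) by (simp add: T_ij[unfolded 1] W(3) Su W(4) del: One_nat_def)
      then show ?thesis using 1 i by (simp add: cc[of i 1, simplified])
    next
      case 2
      have "?T $$ (i, 1) = - b * (col W i \<bullet> col W 0)"
        using ci u(1) by (simp add: T_ij[unfolded 2] W(4) Sv W(3) del: One_nat_def)
      then show ?thesis using 2 i by (simp add: cc[of i 0])
    qed
  qed
  then obtain S' where "S' \<in> carrier_mat n n" "transpose_mat S' = - S'"
    "?T = four_block_mat (skew_diag 2 (\<lambda>_. b)) (0\<^sub>m 2 n) (0\<^sub>m n 2) S'"
    using skew_block_diag[OF T skew_congruence[OF S W(1)] skew_diag_carrier] by blast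
  then show thesis by (rule that[OF W(1,2)])
qed

text \<open>Each step splits off the plane of the eigenvalue with the largest imaginary part, so the
  remaining values cannot exceed it and come out ordered. Padding \<open>l\<close> with zeros beyond
  \<open>n div 2\<close> allows monotonicity to be stated on all naturals.\<close>

theorem real_skew_normal_form:
  fixes S :: "real mat"
  assumes "S \<in> carrier_mat n n" "transpose_mat S = - S"
  shows "\<exists>V l. V \<in> carrier_mat n n \<and> transpose_mat V * V = 1\<^sub>m n \<and>
    transpose_mat V * S * V = skew_diag n l \<and> antimono l \<and> (\<forall>q. 0 \<le> l q) \<and> (\<forall>q\<ge>n div 2. l q = 0)"
  using assms
proof (induction n arbitrary: S rule: less_induct)
  case (less n)
  note S = less.prems
  let ?p = "\<lambda>S. map_poly complex_of_real (char_poly S)"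
  show ?case
  proof (cases "S = 0\<^sub>m n n")
    case True
    have "skew_diag n (\<lambda>_. 0) = (0\<^sub>m n n :: real mat)" by (rule eq_matI) auto
    with True show ?thesis
      by (intro exI[of _ "1\<^sub>m n"] exI[of _ "\<lambda>_. 0"]) (auto simp: antimono_def)
  next
    case False
    have "n \<ge> 2"
    proof (rule ccontr)
      assume n: "\<not> n \<ge> 2"
      have "S $$ (0, 0) = - (S $$ (0, 0))" if "n = 1"
        using arg_cong[OF S(2), of "\<lambda>M. M $$ (0, 0)"] S(1) that by simp
      then have "S = 0\<^sub>m n n" using n S(1) by (intro eq_matI) (auto simp: not_le less_2_cases_iff)
      with False show False by simp
    qed
    then obtain m where n: "n = Suc (Suc m)" by (metis add_2_eq_Suc le_Suc_ex)
    have p0: "?p S \<noteq> 0" using degree_monic_char_poly[OF S(1)] n by auto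
    \<comment> \<open>Imaginary parts of the purely imaginary eigenvalues. Conjugation makes
      \<open>R\<close> symmetric about 0, so a nonzero eigenvalue yields a positive maximum.\<close>
    define R where "R = {b. poly (?p S) (Complex 0 b) = 0}"
    have "finite (Complex 0 -` {z. poly (?p S) z = 0})"
      using poly_roots_finite[OF p0] by (rule finite_vimageI) (simp add: inj_def)
    then have fin: "finite R" unfolding R_def by (rule rev_finite_subset) auto
    obtain z where z: "poly (?p S) z = 0" "Im z \<noteq> 0"
      using real_skew_eq_0[OF S] False by blast
    have "Re z = 0" by (rule real_skew_eigenpair[OF S z(1)])
    then have zeq: "z = Complex 0 (Im z)" by (simp add: complex_eq_iff)
    have "poly (?p S) (cnj z) = 0"
      using real_poly_cnj_root_iff[of "?p S" z] z(1) by (simp add: coeff_map_poly)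
    also have "cnj z = Complex 0 (- Im z)" using \<open>Re z = 0\<close> by (simp add: complex_eq_iff)
    finally have "Im z \<in> R" "- Im z \<in> R" using z(1) zeq by (auto simp: R_def)
    then have "\<bar>Im z\<bar> \<in> R" by (auto simp: abs_if)
    define b where "b = Max R"
    have b: "b \<in> R" "\<And>c. c \<in> R \<Longrightarrow> c \<le> b"
      using fin \<open>\<bar>Im z\<bar> \<in> R\<close> by (auto simp: b_def intro!: Max_in)
    have "b > 0" using b(2)[OF \<open>\<bar>Im z\<bar> \<in> R\<close>] z(2) by linarith
    have root: "poly (?p S) (Complex 0 b) = 0" using b(1) by (simp add: R_def)
    obtain x y where xy: "x \<in> carrier_vec n" "y \<in> carrier_vec n" "x \<noteq> 0\<^sub>v n \<or> y \<noteq> 0\<^sub>v n"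
      "S *\<^sub>v x = (- b) \<cdot>\<^sub>v y" "S *\<^sub>v y = b \<cdot>\<^sub>v x"
      by (rule real_skew_eigenpair[OF S root]) auto
    obtain W S' where W: "W \<in> carrier_mat n n" "transpose_mat W * W = 1\<^sub>m n"
      and S': "S' \<in> carrier_mat m m" "transpose_mat S' = - S'"
      and T: "transpose_mat W * S * W = four_block_mat (skew_diag 2 (\<lambda>_. b)) (0\<^sub>m 2 m) (0\<^sub>m m 2) S'"
      using real_skew_deflate_plane[of S m b x y] S xy \<open>b > 0\<close> unfolding n by blast
    obtain V l where V: "V \<in> carrier_mat m m" "transpose_mat V * V = 1\<^sub>m m"
      and VS: "transpose_mat V * S' * V = skew_diag m l"
      and l: "antimono l" "\<And>q. 0 \<le> l q" "\<And>q. q \<ge> m div 2 \<Longrightarrow> l q = 0"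
      using less.IH[OF _ S'] n by auto
    \<comment> \<open>Up to similarity the blocks of \<open>S'\<close> are blocks of
      \<open>S\<close>, so i times \<open>l 0\<close> is an eigenvalue of \<open>S\<close> and
      \<open>l 0\<close> lies in \<open>R\<close>. If \<open>S'\<close> is too small for a rotation
      block, the zero padding applies.\<close>
    have "l 0 \<le> b"
    proof (cases "m div 2 = 0")
      case True
      then show ?thesis using l(3)[of 0] \<open>b > 0\<close> by simp
    next
      case False
      have "char_poly S = char_poly (transpose_mat W * S * W)"
        by (rule char_poly_similar[symmetric, OF orthogonal_congruence_similar[OF S(1) W]])
      also have "\<dots> = char_poly (skew_diag 2 (\<lambda>_. b)) * char_poly S'"
        unfolding T using S' by (intro char_poly_block_diag) auto
      also have "char_poly S' = char_poly (transpose_mat V * S' * V)"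
        by (rule char_poly_similar[symmetric, OF orthogonal_congruence_similar[OF S'(1) V]])
      also have "\<dots> = (\<Prod>q<m div 2. [:l q ^ 2, 0, 1:]) * [:0, 1:] ^ (m mod 2)"
        unfolding VS by (rule char_poly_skew_diag)
      finally have "[:l 0 ^ 2, 0, 1:] dvd char_poly S"
        using False dvd_prodI[of "{..<m div 2}" 0 "\<lambda>q. [:l q ^ 2, 0, 1:]"] by simp
      then obtain k where "char_poly S = [:l 0 ^ 2, 0, 1:] * k" by (rule dvdE)
      then have "map_poly complex_of_real [:l 0 ^ 2, 0, 1:] dvd ?p S"
        by (simp only: map_poly_of_real_mult dvd_triv_left)
      moreover have "poly (map_poly complex_of_real [:l 0 ^ 2, 0, 1:]) (Complex 0 (l 0)) = 0"
        by (simp add: complex_eq_iff power2_eq_square map_poly_pCons)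
      ultimately have "l 0 \<in> R" unfolding R_def mem_Collect_eq poly_eq_0_iff_dvd by (rule dvd_trans[rotated])
      then show ?thesis by (rule b(2))
    qed
    define U where "U = four_block_mat (1\<^sub>m 2) (0\<^sub>m 2 m) (0\<^sub>m m 2) V"
    have U: "U \<in> carrier_mat n n" "transpose_mat U * U = 1\<^sub>m n"
      using orthogonal_block_mat[OF V, of 2] by (simp_all add: U_def n)
    have Ut: "transpose_mat U = four_block_mat (1\<^sub>m 2) (0\<^sub>m 2 m) (0\<^sub>m m 2) (transpose_mat V)"
      unfolding U_def using V by (subst transpose_four_block_mat[of _ 2 2 _ m _ m]) auto
    define l' where "l' = case_nat b l"
    have "transpose_mat (W * U) * S * (W * U) = transpose_mat U * (transpose_mat W * S * W) * U"
      by (rule congruence_mult[OF S(1) W(1) U(1)])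
    also have "\<dots> = four_block_mat (skew_diag 2 (\<lambda>_. b)) (0\<^sub>m 2 m) (0\<^sub>m m 2) (transpose_mat V * S' * V)"
      unfolding T Ut unfolding U_def using V S'
      by (simp add: mult_four_block_mat[of _ 2 2 _ m _ m _ _ 2 _ m])
    also have "\<dots> = skew_diag n l'"
      unfolding VS n skew_diag_Suc_Suc by (simp add: l'_def)
    finally have "transpose_mat (W * U) * S * (W * U) = skew_diag n l'" .
    moreover have "antimono l'"
      using l(1) order.trans[OF antimonoD[OF l(1)] \<open>l 0 \<le> b\<close>]
      by (auto simp: l'_def antimono_def split: nat.split)
    moreover have "0 \<le> l' q" "q \<ge> n div 2 \<Longrightarrow> l' q = 0" for q
      using l(2,3) \<open>b > 0\<close> n by (auto simp: l'_def split: nat.split)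
    ultimately show ?thesis
      using orthogonal_mult[OF W(1) U(1) W(2) U(2)] W U
      by (intro exI[of _ "W * U"] exI[of _ l']) auto
  qed
qed

section \<open>Representatives of generalized numbers\<close>

lemma net_rel_refl_iff: "net_rel r r \<longleftrightarrow> moderate r"
  by (simp add: net_rel_def negligible_net_zero)

lemma abs_colombeau_eq_iff:
  assumes "moderate r" "moderate s"
  shows "abs_colombeau r = abs_colombeau s \<longleftrightarrow> negligible_net (\<lambda>\<epsilon>. r \<epsilon> - s \<epsilon>)"
proof -
  have "net_rel r s \<longleftrightarrow> net_rel r r \<and> net_rel s s \<and> abs_colombeau r = abs_colombeau s"
    by (rule Quotient_rel[OF Quotient_colombeau, symmetric])
  then show ?thesis unfolding net_rel_refl_iff using assms by (simp add: net_rel_def)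
qed

lemma represents_eq_iff:
  "represents r x \<Longrightarrow> represents s y \<Longrightarrow> x = y \<longleftrightarrow> negligible_net (\<lambda>\<epsilon>. r \<epsilon> - s \<epsilon>)"
  using abs_colombeau_eq_iff[of r s] by (auto simp: represents_def)

lemma represents_eq_0_iff: "represents r x \<Longrightarrow> x = 0 \<longleftrightarrow> negligible_net r"
  using represents_eq_iff[of r x "\<lambda>_. 0" 0]
  by (simp add: represents_def moderate_const zero_colombeau_def)

lemma represents_abs: "moderate r \<Longrightarrow> represents r (abs_colombeau r)"
  by (simp add: represents_def)

lemma negligible_net_norm_le:
  assumes "negligible_net s" "eventually (\<lambda>\<epsilon>. norm (r \<epsilon>) \<le> norm (s \<epsilon>)) (at_right 0)"
  shows "negligible_net r"
proof -
  have "(\<lambda>\<epsilon>. norm (r \<epsilon>)) \<in> O[at_right 0](\<lambda>\<epsilon>. norm (s \<epsilon>))"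
    by (rule landau_o.big_mono) (use assms(2) in simp)
  then show ?thesis
    using assms(1) unfolding negligible_net_def by (meson landau_o.big_trans)
qed

lemma moderate_mono_norm:
  fixes r :: "real \<Rightarrow> 'a::real_normed_field" and s :: "real \<Rightarrow> 'b::real_normed_field"
  assumes "moderate s" "eventually (\<lambda>\<epsilon>. norm (r \<epsilon>) \<le> norm (s \<epsilon>)) (at_right 0)"
  shows "moderate r"
  using moderate_norm_le[of "\<lambda>\<epsilon>. norm (s \<epsilon>)" "\<lambda>\<epsilon>. norm (r \<epsilon>)"] assms by (simp add: moderate_def)

lemma negligible_net_imp_moderate: "negligible_net r \<Longrightarrow> moderate r"
  unfolding negligible_net_def moderate_def by (rule exI[of _ 0], drule spec[of _ 0]) simp

lemma negligible_net_eventually_eq_0: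
  "eventually (\<lambda>\<epsilon>. r \<epsilon> = 0) (at_right 0) \<Longrightarrow> negligible_net r"
  by (rule negligible_net_norm_le[OF negligible_net_zero]) (auto elim: eventually_mono)

lemma negligible_net_sum:
  "(\<And>i. i \<in> I \<Longrightarrow> negligible_net (r i)) \<Longrightarrow> negligible_net (\<lambda>\<epsilon>. \<Sum>i\<in>I. r i \<epsilon>)"
  by (induction I rule: infinite_finite_induct) (auto simp: negligible_net_zero intro: negligible_net_add)

lemma moderate_sum:
  "(\<And>i. i \<in> I \<Longrightarrow> moderate (r i)) \<Longrightarrow> moderate (\<lambda>\<epsilon>. \<Sum>i\<in>I. r i \<epsilon>)"
  by (induction I rule: infinite_finite_induct) (auto simp: moderate_const intro: moderate_add)

lemma moderate_norm_iff: "moderate (\<lambda>\<epsilon>. norm (r \<epsilon>)) \<longleftrightarrow> moderate r"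
  by (simp add: moderate_def)

lemma negligible_net_norm_iff: "negligible_net (\<lambda>\<epsilon>. norm (r \<epsilon>)) \<longleftrightarrow> negligible_net r"
  by (simp add: negligible_net_def)

text \<open>Order \<open>m * Suc N\<close> of the power gives order \<open>m\<close> of the net
  after taking a root.\<close>

lemma negligible_net_power_imp:
  fixes r :: "real \<Rightarrow> 'a::real_normed_field"
  assumes "negligible_net (\<lambda>\<epsilon>. r \<epsilon> ^ Suc N)"
  shows "negligible_net r"
  unfolding negligible_net_def
proof
  fix m :: nat
  have "(\<lambda>\<epsilon>. norm (r \<epsilon> ^ Suc N)) \<in> O[at_right 0](\<lambda>\<epsilon>. \<epsilon> ^ (m * Suc N))"
    using assms unfolding negligible_net_def by blast
  then obtain c where c: "eventually (\<lambda>\<epsilon>. norm (norm (r \<epsilon> ^ Suc N)) \<le> c * norm (\<epsilon> ^ (m * Suc N))) (at_right 0)"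
    by (elim landau_o.bigE)
  \<comment> \<open>With \<open>C\<close> at least 1, its power dominates \<open>c\<close>, so the
    root of the constant needs no computation.\<close>
  define C where "C = max 1 c"
  have "c \<le> C" "1 \<le> C" by (simp_all add: C_def)
  then have "c \<le> C ^ Suc N" using self_le_power[of C "Suc N"] by linarith
  have "eventually (\<lambda>\<epsilon>. norm (norm (r \<epsilon>)) \<le> C * norm (\<epsilon> ^ m)) (at_right 0)"
    using c eventually_at_right_unit
  proof eventually_elim
    case (elim \<epsilon>)
    have "norm (r \<epsilon>) ^ Suc N \<le> c * (\<epsilon> ^ m) ^ Suc N"
      using elim unfolding power_mult[symmetric] norm_power by simp
    also have "\<dots> \<le> C ^ Suc N * (\<epsilon> ^ m) ^ Suc N"
      by (rule mult_right_mono[OF \<open>c \<le> C ^ Suc N\<close>]) (use elim in simp)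
    also have "\<dots> = (C * \<epsilon> ^ m) ^ Suc N" by (simp only: power_mult_distrib)
    finally have "norm (r \<epsilon>) \<le> C * \<epsilon> ^ m"
      by (rule power_le_imp_le_base) (use elim \<open>1 \<le> C\<close> in simp)
    then show ?case using elim by simp
  qed
  then show "(\<lambda>\<epsilon>. norm (r \<epsilon>)) \<in> O[at_right 0](\<lambda>\<epsilon>. \<epsilon> ^ m)" by (rule bigoI)
qed

lemma represents_cong:
  assumes "represents r x" "eventually (\<lambda>\<epsilon>. s \<epsilon> = r \<epsilon>) (at_right 0)"
  shows "represents s x"
proof -
  have r: "moderate r" "abs_colombeau r = x" using assms(1) by (auto simp: represents_def)
  have s: "moderate s"
    by (rule moderate_norm_le[OF r(1)]) (use assms(2) in \<open>auto elim: eventually_mono\<close>)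
  have "negligible_net (\<lambda>\<epsilon>. s \<epsilon> - r \<epsilon>)"
    by (rule negligible_net_eventually_eq_0) (use assms(2) in \<open>auto elim: eventually_mono\<close>)
  then have "abs_colombeau s = abs_colombeau r" using abs_colombeau_eq_iff[OF s r(1)] by simp
  with r s show ?thesis by (simp add: represents_def)
qed

lemma represents_perturb:
  assumes "represents r x" "negligible_net (\<lambda>\<epsilon>. s \<epsilon> - r \<epsilon>)"
  shows "represents s x"
proof -
  have r: "moderate r" "abs_colombeau r = x" using assms(1) by (auto simp: represents_def)
  have "moderate (\<lambda>\<epsilon>. (s \<epsilon> - r \<epsilon>) + r \<epsilon>)"
    using negligible_net_imp_moderate[OF assms(2)] r(1) by (rule moderate_add)
  then have s: "moderate s" by simp
  have "abs_colombeau s = abs_colombeau r" using abs_colombeau_eq_iff[OF s r(1)] assms(2) by simp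
  with r s show ?thesis by (simp add: represents_def)
qed

lemma eventually_at_right_half_open_unit: "eventually (\<lambda>\<epsilon>::real. \<epsilon> \<in> {0<..1}) (at_right 0)"
  using eventually_at_right_unit by eventually_elim auto

lemma represents_cong_unit:
  assumes "represents r x" "\<And>\<epsilon>. \<epsilon> \<in> {0<..1} \<Longrightarrow> s \<epsilon> = r \<epsilon>"
  shows "represents s x"
  using assms(1) by (rule represents_cong) (use eventually_at_right_half_open_unit in eventually_elim, rule assms(2))

section \<open>Representatives of the ring operations\<close>

lemma represents_const: "represents (\<lambda>_. c) (colombeau_const c)"
  by (simp add: represents_def moderate_const colombeau_const_def)

lemma represents_0: "represents (\<lambda>_. 0) 0"
  by (simp add: represents_def moderate_const zero_colombeau_def)

lemma represents_1: "represents (\<lambda>_. 1) 1"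
  by (simp add: represents_def moderate_const one_colombeau_def)

lemma represents_add: "represents r x \<Longrightarrow> represents s y \<Longrightarrow> represents (\<lambda>\<epsilon>. r \<epsilon> + s \<epsilon>) (x + y)"
  unfolding represents_def by (auto simp: moderate_add plus_colombeau.abs_eq net_rel_refl_iff)

lemma represents_mult: "represents r x \<Longrightarrow> represents s y \<Longrightarrow> represents (\<lambda>\<epsilon>. r \<epsilon> * s \<epsilon>) (x * y)"
  unfolding represents_def by (auto simp: moderate_mult times_colombeau.abs_eq net_rel_refl_iff)

lemma represents_uminus: "represents r x \<Longrightarrow> represents (\<lambda>\<epsilon>. - r \<epsilon>) (- x)"
  unfolding represents_def by (auto simp: moderate_uminus uminus_colombeau.abs_eq net_rel_refl_iff)

lemma represents_diff: "represents r x \<Longrightarrow> represents s y \<Longrightarrow> represents (\<lambda>\<epsilon>. r \<epsilon> - s \<epsilon>) (x - y)"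
  unfolding represents_def by (auto simp: moderate_diff minus_colombeau.abs_eq net_rel_refl_iff)

lemma represents_complex_of_colombeau:
  "represents r x \<Longrightarrow> represents (\<lambda>\<epsilon>. complex_of_real (r \<epsilon>)) (complex_of_colombeau x)"
  unfolding represents_def
  by (auto simp: complex_of_colombeau.abs_eq net_rel_refl_iff) (simp add: moderate_def)

lemma represents_sum:
  "(\<And>i. i \<in> I \<Longrightarrow> represents (r i) (x i)) \<Longrightarrow> represents (\<lambda>\<epsilon>. \<Sum>i\<in>I. r i \<epsilon>) (\<Sum>i\<in>I. x i)"
  by (induction I rule: infinite_finite_induct) (auto simp: represents_0 intro: represents_add)

lemma represents_prod:
  "(\<And>i. i \<in> I \<Longrightarrow> represents (r i) (x i)) \<Longrightarrow> represents (\<lambda>\<epsilon>. \<Prod>i\<in>I. r i \<epsilon>) (\<Prod>i\<in>I. x i)"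
  by (induction I rule: infinite_finite_induct) (auto simp: represents_1 intro: represents_mult)

lemma complex_of_colombeau_hom:
  "complex_of_colombeau 0 = 0" "complex_of_colombeau 1 = 1"
  "complex_of_colombeau (- x) = - complex_of_colombeau x"
  "complex_of_colombeau (x * y) = complex_of_colombeau x * complex_of_colombeau y"
proof -
  show "complex_of_colombeau 0 = 0" "complex_of_colombeau 1 = 1"
    by (transfer, simp add: net_rel_refl_iff moderate_const)+
  have eqI: "x = y" if "represents r x" "represents r y" for r :: "real \<Rightarrow> complex" and x y
    using that by (simp add: represents_def)
  note rep = represents_rep[of x] represents_rep[of y]
  show "complex_of_colombeau (- x) = - complex_of_colombeau x"
    using represents_complex_of_colombeau[OF represents_uminus[OF rep(1)]]
      represents_uminus[OF represents_complex_of_colombeau[OF rep(1)]]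
    by (intro eqI) auto
  show "complex_of_colombeau (x * y) = complex_of_colombeau x * complex_of_colombeau y"
    using represents_complex_of_colombeau[OF represents_mult[OF rep]]
      represents_mult[OF represents_complex_of_colombeau[OF rep(1)] represents_complex_of_colombeau[OF rep(2)]]
    by (intro eqI) auto
qed

lemma complex_of_colombeau_eq_0_iff: "complex_of_colombeau x = 0 \<longleftrightarrow> x = 0"
proof -
  have "complex_of_colombeau x = 0 \<longleftrightarrow> negligible_net (\<lambda>\<epsilon>. complex_of_real (rep_colombeau x \<epsilon>))"
    by (rule represents_eq_0_iff[OF represents_complex_of_colombeau[OF represents_rep]])
  also have "\<dots> \<longleftrightarrow> x = 0"
    unfolding represents_eq_0_iff[OF represents_rep[of x]] by (simp add: negligible_net_def)
  finally show ?thesis .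
qed

section \<open>Generalized roots of polynomials\<close>

text \<open>A net determines all coefficients of the polynomial it represents, so identities between
  polynomials that hold at each \<epsilon> pass to generalized numbers.\<close>

definition poly_represents ::
    "(real \<Rightarrow> 'a::real_normed_field poly) \<Rightarrow> 'a colombeau poly \<Rightarrow> bool" where
  "poly_represents p P \<longleftrightarrow> (\<forall>k. represents (\<lambda>\<epsilon>. coeff (p \<epsilon>) k) (coeff P k))"

lemma poly_represents_unique:
  "poly_represents p P \<Longrightarrow> poly_represents p Q \<Longrightarrow> P = Q"
  by (rule poly_eqI) (simp add: poly_represents_def represents_def)

lemma poly_represents_cong_unit:
  assumes "poly_represents p P" "\<And>\<epsilon>. \<epsilon> \<in> {0<..1} \<Longrightarrow> q \<epsilon> = p \<epsilon>"
  shows "poly_represents q P"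
  using assms represents_cong_unit unfolding poly_represents_def
  by (smt (verit))

lemma poly_represents_0: "poly_represents (\<lambda>_. 0) 0"
  by (simp add: poly_represents_def represents_0)

lemma poly_represents_pCons:
  "represents r x \<Longrightarrow> poly_represents p P \<Longrightarrow> poly_represents (\<lambda>\<epsilon>. pCons (r \<epsilon>) (p \<epsilon>)) (pCons x P)"
  by (auto simp: poly_represents_def coeff_pCons split: nat.split)

lemma poly_represents_1: "poly_represents (\<lambda>_. 1) 1"
  unfolding one_pCons by (intro poly_represents_pCons represents_1 poly_represents_0)

lemma poly_represents_add:
  "poly_represents p P \<Longrightarrow> poly_represents q Q \<Longrightarrow> poly_represents (\<lambda>\<epsilon>. p \<epsilon> + q \<epsilon>) (P + Q)"
  by (simp add: poly_represents_def represents_add)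

lemma poly_represents_mult:
  "poly_represents p P \<Longrightarrow> poly_represents q Q \<Longrightarrow> poly_represents (\<lambda>\<epsilon>. p \<epsilon> * q \<epsilon>) (P * Q)"
  by (simp add: poly_represents_def coeff_mult represents_sum represents_mult)

lemma poly_represents_sum:
  "(\<And>i. i \<in> I \<Longrightarrow> poly_represents (p i) (P i)) \<Longrightarrow>
    poly_represents (\<lambda>\<epsilon>. \<Sum>i\<in>I. p i \<epsilon>) (\<Sum>i\<in>I. P i)"
  by (induction I rule: infinite_finite_induct) (auto simp: poly_represents_0 intro: poly_represents_add)

lemma poly_represents_prod:
  "(\<And>i. i \<in> I \<Longrightarrow> poly_represents (p i) (P i)) \<Longrightarrow>
    poly_represents (\<lambda>\<epsilon>. \<Prod>i\<in>I. p i \<epsilon>) (\<Prod>i\<in>I. P i)"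
  by (induction I rule: infinite_finite_induct) (auto simp: poly_represents_1 intro: poly_represents_mult)

lemma poly_represents_linear_factor:
  "represents r x \<Longrightarrow> poly_represents (\<lambda>\<epsilon>. [:- r \<epsilon>, 1:]) [:- x, 1:]"
  by (intro poly_represents_pCons represents_uminus represents_1 poly_represents_0)

text \<open>The Leibniz expansion of the determinant is built from sums and products of entries, and
  representatives respect these. The same expression \<open>?S\<close> serves over the field and
  over the generalized numbers.\<close>

lemma poly_represents_char_poly:
  assumes A: "A \<in> carrier_mat n n" and M: "mat_represents n M A"
  shows "poly_represents (\<lambda>\<epsilon>. char_poly (M \<epsilon>)) (char_poly A)"
proof -
  have entry: "poly_represents (\<lambda>\<epsilon>. [:0, 1:] * (if i = j then 1 else 0) + [:- M \<epsilon> $$ (i, j):])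
      ([:0, 1:] * (if i = j then 1 else 0) + [:- A $$ (i, j):])" if "i < n" "j < n" for i j
  proof (intro poly_represents_add poly_represents_mult)
    show "poly_represents (\<lambda>\<epsilon>. if i = j then 1 else 0 :: 'a poly) (if i = j then 1 else 0)"
      by (simp add: poly_represents_0 poly_represents_1)
  qed (use M that in \<open>auto simp: mat_represents_def intro!: poly_represents_pCons represents_0 represents_1
        poly_represents_0 represents_uminus\<close>)
  have sgn: "poly_represents (\<lambda>_. signof p :: 'a poly) (signof p)" for p :: "nat \<Rightarrow> nat"
  proof -
    have "poly_represents (\<lambda>_. - 1 :: 'a poly) (- 1)"
      by (simp add: poly_represents_def represents_uminus poly_represents_1[unfolded poly_represents_def, rule_format, simplified])
    then show ?thesis by (simp add: sign_def poly_represents_1)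
  qed
  let ?S = "\<lambda>B. \<Sum>p | p permutes {0..<n}. signof p *
      (\<Prod>i = 0..<n. [:0, 1:] * (if i = p i then 1 else 0) + [:- B $$ (i, p i):])"
  have char: "char_poly B = ?S B" if B: "B \<in> carrier_mat n n" for B :: "'b::comm_ring_1 mat"
    unfolding char_poly_def det_def'[OF char_poly_matrix_closed[OF B]]
    by (intro sum.cong refl arg_cong2[of _ _ _ _ "(*)"] prod.cong)
      (use B in \<open>auto simp: char_poly_matrix_def\<close>)
  have "poly_represents (\<lambda>\<epsilon>. ?S (M \<epsilon>)) (?S A)"
    by (intro poly_represents_sum poly_represents_mult poly_represents_prod sgn entry)
      (auto simp: permutes_in_image)
  then have "poly_represents (\<lambda>\<epsilon>. char_poly (M \<epsilon>)) (?S A)"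
    by (rule poly_represents_cong_unit) (use M in \<open>auto simp: mat_represents_def char\<close>)
  then show ?thesis by (simp add: char[OF A])
qed

section \<open>Comparing two factorizations into linear factors\<close>

text \<open>The generalized numbers have zero divisors, so cancellation rests on the factor being
  monic: multiplication by it moves the leading coefficient one degree up without changing
  it.\<close>

lemma linear_factor_mult_cancel:
  fixes a :: "'a::comm_ring_1"
  assumes "[:- a, 1:] * P = [:- a, 1:] * Q"
  shows "P = Q"
proof (rule ccontr)
  let ?R = "P - Q"
  assume "P \<noteq> Q"
  then have "coeff ?R (degree ?R) \<noteq> 0" by (simp only: leading_coeff_0_iff) simp
  moreover have "[:- a, 1:] * ?R = 0" using assms by (simp only: right_diff_distrib) simp
  then have "coeff ([:- a, 1:] * ?R) (Suc (degree ?R)) = 0" by simp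
  moreover have "coeff ([:- a, 1:] * R) (Suc (degree R)) = coeff R (degree R)" for R
    by (simp add: coeff_eq_0)
  ultimately have "coeff ?R (degree ?R) = 0" by (simp only:)
  with \<open>coeff ?R (degree ?R) \<noteq> 0\<close> show False by simp
qed

text \<open>At each \<open>\<epsilon>\<close>, the root of the second polynomial closest to a given root of the first one is at
  a distance whose \<open>n\<close>-th power is bounded by the value of the second polynomial.\<close>

lemma root_matching:
  fixes a b :: "nat \<Rightarrow> real \<Rightarrow> 'a::real_normed_field"
  assumes "\<And>k. k < n \<Longrightarrow> moderate (a k)" "\<And>k. k < n \<Longrightarrow> moderate (b k)"
    and "(\<Prod>k<n. [:- abs_colombeau (a k), 1:]) = (\<Prod>k<n. [:- abs_colombeau (b k), 1:])"
  shows "\<exists>\<sigma>. (\<forall>\<epsilon>. \<sigma> \<epsilon> permutes {..<n}) \<and> (\<forall>k<n. negligible_net (\<lambda>\<epsilon>. a k \<epsilon> - b (\<sigma> \<epsilon> k) \<epsilon>))"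
  using assms
proof (induction n arbitrary: b)
  case 0
  show ?case by (rule exI[of _ "\<lambda>_. id"]) (simp add: permutes_id[unfolded id_def] id_def)
next
  case (Suc n)
  let ?\<alpha> = "\<lambda>k. abs_colombeau (a k)"
  define j where "j \<epsilon> = arg_min_on (\<lambda>k. norm (a n \<epsilon> - b k \<epsilon>)) {..<Suc n}" for \<epsilon>
  have "{..<Suc n} \<noteq> {}" by blast
  note min = arg_min_if_finite[OF finite_lessThan this]
  have j: "j \<epsilon> < Suc n" for \<epsilon> using min(1) by (simp only: j_def lessThan_iff)
  have le: "norm (a n \<epsilon> - b (j \<epsilon>) \<epsilon>) \<le> norm (a n \<epsilon> - b k \<epsilon>)" if "k < Suc n" for \<epsilon> k
  proof -
    have "\<not> (\<exists>k\<in>{..<Suc n}. norm (a n \<epsilon> - b k \<epsilon>) < norm (a n \<epsilon> - b (j \<epsilon>) \<epsilon>))"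
      unfolding j_def by (rule min(2))
    with that show ?thesis by (metis lessThan_iff not_less)
  qed
  \<comment> \<open>Swaps the index of the closest root into the last position, where the induction
    can remove it.\<close>
  define \<tau> where "\<tau> \<epsilon> = transpose n (j \<epsilon>)" for \<epsilon>
  define b' where "b' k \<epsilon> = b (\<tau> \<epsilon> k) \<epsilon>" for k \<epsilon>
  have \<tau>: "\<tau> \<epsilon> permutes {..<Suc n}" for \<epsilon>
    unfolding \<tau>_def using j by (intro permutes_swap_id) auto
  \<comment> \<open>As \<open>b' k\<close> switches between the nets \<open>b i\<close> when
    \<epsilon> varies, it is bounded by the sum of all of them.\<close>
  have mod_b': "moderate (b' k)" if "k < Suc n" for k
  proof (rule moderate_mono_norm[of "\<lambda>\<epsilon>. \<Sum>i<Suc n. norm (b i \<epsilon>)"])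
    show "moderate (\<lambda>\<epsilon>. \<Sum>i<Suc n. norm (b i \<epsilon>))"
      using Suc.prems(2) by (intro moderate_sum) (auto simp: moderate_norm_iff)
    have "norm (b' k \<epsilon>) \<le> (\<Sum>i<Suc n. norm (b i \<epsilon>))" for \<epsilon>
      unfolding b'_def using that permutes_in_image[OF \<tau>, of \<epsilon> k]
      by (intro member_le_sum) auto
    then show "\<forall>\<^sub>F \<epsilon> in at_right 0. norm (b' k \<epsilon>) \<le> norm (\<Sum>i<Suc n. norm (b i \<epsilon>))"
      by (intro always_eventually allI) (use abs_ge_self order.trans in \<open>fastforce simp only: real_norm_def\<close>)
  qed
  have b'n: "b' n \<epsilon> = b (j \<epsilon>) \<epsilon>" for \<epsilon> by (simp add: b'_def \<tau>_def)
  \<comment> \<open>The nets \<open>b' k\<close> need not represent the same classes as the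
    \<open>b k\<close>, but at each \<epsilon> the product is insensitive to the order of its
    factors, hence so is its class.\<close>
  have eq_prod: "(\<Prod>k<Suc n. [:- abs_colombeau (b k), 1:]) = (\<Prod>k<Suc n. [:- abs_colombeau (b' k), 1:])"
  proof (rule poly_represents_unique)
    show "poly_represents (\<lambda>\<epsilon>. \<Prod>k<Suc n. [:- b k \<epsilon>, 1:]) (\<Prod>k<Suc n. [:- abs_colombeau (b k), 1:])"
      using Suc.prems(2) by (intro poly_represents_prod poly_represents_linear_factor represents_abs) auto
    have "poly_represents (\<lambda>\<epsilon>. \<Prod>k<Suc n. [:- b' k \<epsilon>, 1:]) (\<Prod>k<Suc n. [:- abs_colombeau (b' k), 1:])"
      using mod_b' by (intro poly_represents_prod poly_represents_linear_factor represents_abs) auto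
    also have "(\<lambda>\<epsilon>. \<Prod>k<Suc n. [:- b' k \<epsilon>, 1:]) = (\<lambda>\<epsilon>. \<Prod>k<Suc n. [:- b k \<epsilon>, 1:])"
      unfolding b'_def by (rule ext) (rule prod.permute[OF \<tau>, symmetric, unfolded o_def])
    finally show "poly_represents (\<lambda>\<epsilon>. \<Prod>k<Suc n. [:- b k \<epsilon>, 1:]) (\<Prod>k<Suc n. [:- abs_colombeau (b' k), 1:])" .
  qed
  \<comment> \<open>The product of all distances from \<open>a n\<close> represents the value of the
    second polynomial at a root of the first. Both polynomials coincide, so this product is
    negligible, and it dominates the power of the smallest distance.\<close>
  have close: "negligible_net (\<lambda>\<epsilon>. a n \<epsilon> - b' n \<epsilon>)"
  proof (rule negligible_net_power_imp[of _ n], rule negligible_net_norm_le)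
    have "represents (\<lambda>\<epsilon>. \<Prod>k<Suc n. a n \<epsilon> - b k \<epsilon>) (\<Prod>k<Suc n. ?\<alpha> n - abs_colombeau (b k))"
      using Suc.prems(1,2) by (intro represents_prod represents_diff represents_abs) auto
    also have "(\<Prod>k<Suc n. ?\<alpha> n - abs_colombeau (b k)) = poly (\<Prod>k<Suc n. [:- abs_colombeau (b k), 1:]) (?\<alpha> n)"
      by (simp add: poly_prod del: prod.lessThan_Suc)
    also have "\<dots> = 0" unfolding Suc.prems(3)[symmetric] by (simp add: poly_prod)
    finally show "negligible_net (\<lambda>\<epsilon>. \<Prod>k<Suc n. a n \<epsilon> - b k \<epsilon>)"
      using represents_eq_0_iff by blast
    have "norm ((a n \<epsilon> - b' n \<epsilon>) ^ Suc n) \<le> norm (\<Prod>k<Suc n. a n \<epsilon> - b k \<epsilon>)" for \<epsilon>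
    proof -
      have "norm ((a n \<epsilon> - b' n \<epsilon>) ^ Suc n) = (\<Prod>k<Suc n. norm (a n \<epsilon> - b' n \<epsilon>))"
        by (simp add: norm_power norm_mult)
      also have "\<dots> \<le> (\<Prod>k<Suc n. norm (a n \<epsilon> - b k \<epsilon>))"
        by (rule prod_mono) (use le in \<open>auto simp: b'n\<close>)
      finally show ?thesis by (simp only: prod_norm)
    qed
    then show "\<forall>\<^sub>F \<epsilon> in at_right 0. norm ((a n \<epsilon> - b' n \<epsilon>) ^ Suc n) \<le> norm (\<Prod>k<Suc n. a n \<epsilon> - b k \<epsilon>)"
      by (intro always_eventually allI)
  qed
  then have eqn: "?\<alpha> n = abs_colombeau (b' n)"
    using abs_colombeau_eq_iff[OF Suc.prems(1) mod_b'] by simp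
  have "[:- ?\<alpha> n, 1:] * (\<Prod>k<n. [:- ?\<alpha> k, 1:]) = [:- ?\<alpha> n, 1:] * (\<Prod>k<n. [:- abs_colombeau (b' k), 1:])"
    using Suc.prems(3) unfolding eq_prod by (simp only: prod.lessThan_Suc mult.commute eqn)
  then have "(\<Prod>k<n. [:- ?\<alpha> k, 1:]) = (\<Prod>k<n. [:- abs_colombeau (b' k), 1:])"
    by (rule linear_factor_mult_cancel)
  then obtain \<sigma> where \<sigma>: "\<And>\<epsilon>. \<sigma> \<epsilon> permutes {..<n}" "\<And>k. k < n \<Longrightarrow> negligible_net (\<lambda>\<epsilon>. a k \<epsilon> - b' (\<sigma> \<epsilon> k) \<epsilon>)"
    using Suc.IH[of b'] Suc.prems(1) mod_b' by auto
  have \<sigma>': "\<sigma> \<epsilon> permutes {..<Suc n}" "\<sigma> \<epsilon> n = n" for \<epsilon>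
    using permutes_subset[OF \<sigma>(1)] permutes_not_in[OF \<sigma>(1)] by auto
  show ?case
  proof (intro exI[of _ "\<lambda>\<epsilon>. \<tau> \<epsilon> \<circ> \<sigma> \<epsilon>"] conjI allI impI)
    show "\<tau> \<epsilon> \<circ> \<sigma> \<epsilon> permutes {..<Suc n}" for \<epsilon> using \<sigma>'(1) \<tau> by (rule permutes_compose)
    fix k assume "k < Suc n"
    then consider "k < n" | "k = n" by linarith
    then have "negligible_net (\<lambda>\<epsilon>. a k \<epsilon> - b' (\<sigma> \<epsilon> k) \<epsilon>)"
      using \<sigma>(2) close by cases (simp_all add: \<sigma>'(2))
    then show "negligible_net (\<lambda>\<epsilon>. a k \<epsilon> - b ((\<tau> \<epsilon> \<circ> \<sigma> \<epsilon>) k) \<epsilon>)" by (simp add: b'_def)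
  qed
qed

section \<open>Sorting does not increase the error of a matching\<close>

text \<open>Pigeonhole: if \<open>y k\<close> were too large, the partners of \<open>y 0\<close> to
  \<open>y k\<close> would all have values above \<open>x k\<close> and hence indices below
  \<open>k\<close>, which leaves only \<open>k\<close> places for \<open>k + 1\<close> distinct
  indices.\<close>

lemma antitone_matching_le:
  fixes x y :: "nat \<Rightarrow> real"
  assumes x: "\<And>i j. i \<le> j \<Longrightarrow> j < n \<Longrightarrow> x j \<le> x i" and y: "\<And>i j. i \<le> j \<Longrightarrow> j < n \<Longrightarrow> y j \<le> y i"
    and \<sigma>: "\<sigma> permutes {..<n}" and close: "\<And>k. k < n \<Longrightarrow> \<bar>x k - y (\<sigma> k)\<bar> \<le> \<delta>" and k: "k < n"
  shows "y k \<le> x k + \<delta>"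
proof (rule ccontr)
  assume neg: "\<not> y k \<le> x k + \<delta>"
  let ?\<rho> = "inv_into UNIV \<sigma>"
  have "?\<rho> j < k" if "j \<le> k" for j
  proof -
    have "\<sigma> (?\<rho> j) = j" "?\<rho> j < n"
      using permutes_inverses(1)[OF \<sigma>] permutes_in_image[OF permutes_inv[OF \<sigma>], of j] that k by auto
    then have "\<bar>x (?\<rho> j) - y j\<bar> \<le> \<delta>" using close[of "?\<rho> j"] by simp
    then have "x (?\<rho> j) > x k" using neg y[OF that k] by linarith
    then show ?thesis using x[OF _ \<open>?\<rho> j < n\<close>, of k] by (meson not_le)
  qed
  then have "?\<rho> ` {..k} \<subseteq> {..<k}" by auto
  moreover have "inj_on ?\<rho> {..k}" using permutes_inj[OF permutes_inv[OF \<sigma>]] inj_on_subset by blast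
  ultimately have "card {..k} \<le> card {..<k}" by (intro card_inj_on_le[of ?\<rho>]) auto
  then show False by simp
qed

lemma sorted_matching_le:
  fixes x y :: "nat \<Rightarrow> real"
  assumes x: "\<And>i j. i \<le> j \<Longrightarrow> j < n \<Longrightarrow> x j \<le> x i" and y: "\<And>i j. i \<le> j \<Longrightarrow> j < n \<Longrightarrow> y j \<le> y i"
    and \<sigma>: "\<sigma> permutes {..<n}" and close: "\<And>k. k < n \<Longrightarrow> \<bar>x k - y (\<sigma> k)\<bar> \<le> \<delta>" and k: "k < n"
  shows "\<bar>x k - y k\<bar> \<le> \<delta>"
proof -
  have inv_close: "\<bar>y i - x (inv_into UNIV \<sigma> i)\<bar> \<le> \<delta>" if "i < n" for i
    using close[of "inv_into UNIV \<sigma> i"] permutes_inverses(1)[OF \<sigma>]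
      permutes_in_image[OF permutes_inv[OF \<sigma>], of i] that by (auto simp: abs_minus_commute)
  have "x k \<le> y k + \<delta>"
    by (rule antitone_matching_le[where x = y and y = x, OF y x permutes_inv[OF \<sigma>] inv_close k])
  moreover have "y k \<le> x k + \<delta>" by (rule antitone_matching_le[where x = x and y = y, OF x y \<sigma> close k])
  ultimately show ?thesis by linarith
qed

text \<open>Makes the distinguished tuple independent of the representative. Here \<open>b\<close>
  comes from skew matrices, whereas \<open>a\<close> may come from any representative, so only
  \<open>b\<close> is assumed purely imaginary. Sorting controls the imaginary parts.\<close>

lemma sorted_roots_unique:
  fixes a b :: "nat \<Rightarrow> real \<Rightarrow> complex"
  assumes a: "\<And>k. k < n \<Longrightarrow> represents (a k) (\<alpha> k)" and b: "\<And>k. k < n \<Longrightarrow> represents (b k) (\<beta> k)"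
    and eq: "(\<Prod>k<n. [:- \<alpha> k, 1:]) = (\<Prod>k<n. [:- \<beta> k, 1:])"
    and a_sorted: "\<And>\<epsilon> i j. \<epsilon> \<in> {0<..1} \<Longrightarrow> i \<le> j \<Longrightarrow> j < n \<Longrightarrow> Im (a j \<epsilon>) \<le> Im (a i \<epsilon>)"
    and b_sorted: "\<And>\<epsilon> i j. \<epsilon> \<in> {0<..1} \<Longrightarrow> i \<le> j \<Longrightarrow> j < n \<Longrightarrow> Im (b j \<epsilon>) \<le> Im (b i \<epsilon>)"
    and b_imag: "\<And>\<epsilon> k. \<epsilon> \<in> {0<..1} \<Longrightarrow> k < n \<Longrightarrow> Re (b k \<epsilon>) = 0"
    and k: "k < n"
  shows "\<alpha> k = \<beta> k"
proof -
  have ma: "moderate (a k)" "abs_colombeau (a k) = \<alpha> k" if "k < n" for k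
    using a[OF that] by (auto simp: represents_def)
  have mb: "moderate (b k)" "abs_colombeau (b k) = \<beta> k" if "k < n" for k
    using b[OF that] by (auto simp: represents_def)
  have "(\<Prod>k<n. [:- abs_colombeau (a k), 1:]) = (\<Prod>k<n. [:- abs_colombeau (b k), 1:])"
    using eq ma mb by simp
  then obtain \<sigma> where \<sigma>: "\<And>\<epsilon>. \<sigma> \<epsilon> permutes {..<n}"
      "\<And>k. k < n \<Longrightarrow> negligible_net (\<lambda>\<epsilon>. a k \<epsilon> - b (\<sigma> \<epsilon> k) \<epsilon>)"
    using root_matching[of n a b] ma mb by auto
  define \<delta> where "\<delta> \<epsilon> = (\<Sum>i<n. norm (a i \<epsilon> - b (\<sigma> \<epsilon> i) \<epsilon>))" for \<epsilon>
  have \<delta>: "negligible_net \<delta>"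
    unfolding \<delta>_def using \<sigma>(2) by (intro negligible_net_sum) (auto simp: negligible_net_norm_iff)
  have le2: "norm (a k \<epsilon> - b k \<epsilon>) \<le> \<delta> \<epsilon> + \<delta> \<epsilon>" if \<epsilon>: "\<epsilon> \<in> {0<..1}" for \<epsilon>
  proof -
    have le: "norm (a i \<epsilon> - b (\<sigma> \<epsilon> i) \<epsilon>) \<le> \<delta> \<epsilon>" if "i < n" for i
      unfolding \<delta>_def by (rule member_le_sum) (use that in auto)
    have "\<bar>Im (a i \<epsilon>) - Im (b (\<sigma> \<epsilon> i) \<epsilon>)\<bar> \<le> \<delta> \<epsilon>" if "i < n" for i
      using order.trans[OF abs_Im_le_cmod le[OF that]] by simp
    then have "\<bar>Im (a k \<epsilon>) - Im (b k \<epsilon>)\<bar> \<le> \<delta> \<epsilon>"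
      by (intro sorted_matching_le[where x = "\<lambda>i. Im (a i \<epsilon>)" and y = "\<lambda>i. Im (b i \<epsilon>)",
            OF a_sorted[OF \<epsilon>] b_sorted[OF \<epsilon>] \<sigma>(1) _ k])
    \<comment> \<open>For real parts the permutation is harmless: every candidate partner has real
      part 0.\<close>
    moreover have "\<sigma> \<epsilon> k < n" using permutes_in_image[OF \<sigma>(1), of \<epsilon> k] k by simp
    then have "Re (b (\<sigma> \<epsilon> k) \<epsilon>) = 0" "Re (b k \<epsilon>) = 0"
      using b_imag[OF \<epsilon>] k by simp_all
    then have "\<bar>Re (a k \<epsilon> - b k \<epsilon>)\<bar> \<le> \<delta> \<epsilon>"
      using order.trans[OF abs_Re_le_cmod le[OF k]] by simp
    ultimately show ?thesis using cmod_le[of "a k \<epsilon> - b k \<epsilon>"] by simp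
  qed
  have "norm (a k \<epsilon> - b k \<epsilon>) \<le> norm (\<delta> \<epsilon> + \<delta> \<epsilon>)" if "\<epsilon> \<in> {0<..1}" for \<epsilon>
    using le2[OF that] unfolding real_norm_def by linarith
  then have "negligible_net (\<lambda>\<epsilon>. a k \<epsilon> - b k \<epsilon>)"
    by (intro negligible_net_norm_le[OF negligible_net_add[OF \<delta> \<delta>]]
          eventually_mono[OF eventually_at_right_half_open_unit])
  then show ?thesis using represents_eq_iff[OF a[OF k] b[OF k]] by simp
qed

section \<open>The normal form over the generalized numbers\<close>

lemma represents_unique: "represents r x \<Longrightarrow> represents r y \<Longrightarrow> x = y"
  by (simp add: represents_def)

section \<open>Nets of matrices\<close>

lemma mat_represents_mult:
  assumes A: "A \<in> carrier_mat n n" "mat_represents n M A" and B: "B \<in> carrier_mat n n" "mat_represents n N B"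
  shows "mat_represents n (\<lambda>\<epsilon>. M \<epsilon> * N \<epsilon>) (A * B)"
  unfolding mat_represents_def
proof (intro conjI ballI allI impI)
  have M: "M \<epsilon> \<in> carrier_mat n n" and N: "N \<epsilon> \<in> carrier_mat n n" if "\<epsilon> \<in> {0<..1}" for \<epsilon>
    using A(2) B(2) that by (auto simp: mat_represents_def)
  show "M \<epsilon> * N \<epsilon> \<in> carrier_mat n n" if "\<epsilon> \<in> {0<..1}" for \<epsilon>
    using M[OF that] N[OF that] by (rule mult_carrier_mat)
  fix i j assume i: "i < n" and j: "j < n"
  have "represents (\<lambda>\<epsilon>. \<Sum>k<n. M \<epsilon> $$ (i, k) * N \<epsilon> $$ (k, j)) (\<Sum>k<n. A $$ (i, k) * B $$ (k, j))"
    using A(2) B(2) i j by (intro represents_sum represents_mult) (auto simp: mat_represents_def)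
  then have "represents (\<lambda>\<epsilon>. (M \<epsilon> * N \<epsilon>) $$ (i, j)) (\<Sum>k<n. A $$ (i, k) * B $$ (k, j))"
    by (rule represents_cong_unit)
      (use carrier_matD[OF M] carrier_matD[OF N] i j in \<open>simp add: scalar_prod_def lessThan_atLeast0\<close>)
  then show "represents (\<lambda>\<epsilon>. (M \<epsilon> * N \<epsilon>) $$ (i, j)) ((A * B) $$ (i, j))"
    using A(1) B(1) i j by (simp add: scalar_prod_def lessThan_atLeast0)
qed

lemma mat_represents_transpose:
  assumes "A \<in> carrier_mat n n" "mat_represents n M A"
  shows "mat_represents n (\<lambda>\<epsilon>. transpose_mat (M \<epsilon>)) (transpose_mat A)"
  unfolding mat_represents_def
proof (intro conjI ballI allI impI)
  have M: "M \<epsilon> \<in> carrier_mat n n" if "\<epsilon> \<in> {0<..1}" for \<epsilon>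
    using assms(2) that by (simp add: mat_represents_def)
  then show "transpose_mat (M \<epsilon>) \<in> carrier_mat n n" if "\<epsilon> \<in> {0<..1}" for \<epsilon>
    using that by simp
  fix i j assume "i < n" "j < n"
  then have "represents (\<lambda>\<epsilon>. M \<epsilon> $$ (j, i)) (transpose_mat A $$ (i, j))"
    using assms by (simp add: mat_represents_def)
  then show "represents (\<lambda>\<epsilon>. transpose_mat (M \<epsilon>) $$ (i, j)) (transpose_mat A $$ (i, j))"
    by (rule represents_cong_unit) (use carrier_matD[OF M] \<open>i < n\<close> \<open>j < n\<close> in simp)
qed

lemma mat_represents_complex:
  assumes "A \<in> carrier_mat n n" "mat_represents n M A"
  shows "mat_represents n (\<lambda>\<epsilon>. map_mat complex_of_real (M \<epsilon>)) (map_mat complex_of_colombeau A)"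
  unfolding mat_represents_def
proof (intro conjI ballI allI impI)
  have M: "M \<epsilon> \<in> carrier_mat n n" if "\<epsilon> \<in> {0<..1}" for \<epsilon>
    using assms(2) that by (simp add: mat_represents_def)
  then show "map_mat complex_of_real (M \<epsilon>) \<in> carrier_mat n n" if "\<epsilon> \<in> {0<..1}" for \<epsilon>
    using that by simp
  fix i j assume ij: "i < n" "j < n"
  then have "represents (\<lambda>\<epsilon>. complex_of_real (M \<epsilon> $$ (i, j))) (map_mat complex_of_colombeau A $$ (i, j))"
    using assms by (simp add: mat_represents_def represents_complex_of_colombeau)
  then show "represents (\<lambda>\<epsilon>. map_mat complex_of_real (M \<epsilon>) $$ (i, j)) (map_mat complex_of_colombeau A $$ (i, j))"
    by (rule represents_cong_unit) (use carrier_matD[OF M] ij in simp)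
qed

lemma mat_represents_eqI:
  assumes "A \<in> carrier_mat n n" "B \<in> carrier_mat n n" "mat_represents n M A"
    and "\<And>i j. i < n \<Longrightarrow> j < n \<Longrightarrow> represents (\<lambda>\<epsilon>. M \<epsilon> $$ (i, j)) (B $$ (i, j))"
  shows "A = B"
proof (rule eq_matI)
  fix i j assume "i < dim_row B" "j < dim_col B"
  then have ij: "i < n" "j < n" using assms(2) by auto
  then have "represents (\<lambda>\<epsilon>. M \<epsilon> $$ (i, j)) (A $$ (i, j))"
    using assms(3) by (simp add: mat_represents_def)
  then show "A $$ (i, j) = B $$ (i, j)" using assms(4)[OF ij] by (rule represents_unique)
qed (use assms(1,2) in auto)

lemma mat_represents_orthogonal:
  assumes A: "A \<in> carrier_mat n n" "mat_represents n M A" and B: "B \<in> carrier_mat n n" "mat_represents n N B"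
    and "\<And>\<epsilon>. M \<epsilon> * N \<epsilon> = 1\<^sub>m n"
  shows "A * B = 1\<^sub>m n"
  using A(1) B(1) mat_represents_mult[OF A B] assms(5)
  by (intro mat_represents_eqI[of _ n _ "\<lambda>_. 1\<^sub>m n"]) (auto simp: represents_0 represents_1)

text \<open>Antisymmetrizing any representative changes entry \<open>(i, j)\<close> by minus half
  the sum of the entries \<open>(i, j)\<close> and \<open>(j, i)\<close>, which is negligible
  because \<open>A\<close> is skew.\<close>

lemma skew_representative:
  fixes A :: "real colombeau mat"
  assumes A: "A \<in> carrier_mat n n" "transpose_mat A = - A"
  obtains S where "mat_represents n S A" "\<And>\<epsilon>. S \<epsilon> \<in> carrier_mat n n" "\<And>\<epsilon>. transpose_mat (S \<epsilon>) = - S \<epsilon>"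
proof -
  define r where "r i j = rep_colombeau (A $$ (i, j))" for i j
  define S where "S \<epsilon> = mat n n (\<lambda>(i, j). (r i j \<epsilon> - r j i \<epsilon>) / 2)" for \<epsilon>
  have r: "represents (r i j) (A $$ (i, j))" for i j by (simp add: r_def represents_rep)
  have "represents (\<lambda>\<epsilon>. (r i j \<epsilon> - r j i \<epsilon>) / 2) (A $$ (i, j))" if "i < n" "j < n" for i j
  proof (rule represents_perturb[OF r])
    have "A $$ (i, j) + A $$ (j, i) = 0"
      using arg_cong[OF A(2), of "\<lambda>M. M $$ (i, j)"] A(1) that by simp
    then have "negligible_net (\<lambda>\<epsilon>. r i j \<epsilon> + r j i \<epsilon>)"
      using represents_eq_0_iff[OF represents_add[OF r r]] by blast
    then have "negligible_net (\<lambda>\<epsilon>. (r i j \<epsilon> + r j i \<epsilon>) * (- 1 / 2))"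
      by (rule negligible_net_mult[OF _ moderate_const])
    also have "(\<lambda>\<epsilon>. (r i j \<epsilon> + r j i \<epsilon>) * (- 1 / 2)) = (\<lambda>\<epsilon>. (r i j \<epsilon> - r j i \<epsilon>) / 2 - r i j \<epsilon>)"
      by (rule ext) (simp add: field_simps)
    finally show "negligible_net (\<lambda>\<epsilon>. (r i j \<epsilon> - r j i \<epsilon>) / 2 - r i j \<epsilon>)" .
  qed
  then have "mat_represents n S A" by (simp add: mat_represents_def S_def)
  moreover have "transpose_mat (S \<epsilon>) = - S \<epsilon>" for \<epsilon>
    by (rule eq_matI) (auto simp: S_def field_simps)
  ultimately show thesis using that[of S] by (simp add: S_def)
qed

text \<open>Columns have unit length. The bound is uniform in \<epsilon>, so orthogonal matrices
  chosen arbitrarily at each \<epsilon> form a moderate net.\<close>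

lemma orthogonal_entry_le_1:
  fixes V :: "real mat"
  assumes "V \<in> carrier_mat n n" "transpose_mat V * V = 1\<^sub>m n" "i < n" "j < n"
  shows "\<bar>V $$ (i, j)\<bar> \<le> 1"
proof -
  have "(\<Sum>k<n. V $$ (k, j) * V $$ (k, j)) = (transpose_mat V * V) $$ (j, j)"
    using assms(1,3,4) by (simp add: scalar_prod_def lessThan_atLeast0)
  then have "(\<Sum>k<n. V $$ (k, j) * V $$ (k, j)) = 1" using assms by simp
  moreover have "V $$ (i, j) * V $$ (i, j) \<le> (\<Sum>k<n. V $$ (k, j) * V $$ (k, j))"
    by (rule member_le_sum) (use assms in auto)
  ultimately have "(V $$ (i, j))\<^sup>2 \<le> 1" by (simp only: power2_eq_square)
  then show ?thesis by (simp only: abs_square_le_1)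
qed

section \<open>The distinguished tuple of the normal form\<close>

text \<open>Lists the values \<open>z q\<close>, then a middle 0 if \<open>n\<close> is odd, then
  the negatives in reverse order. For \<open>z q\<close> equal to i times a decreasing nonnegative
  sequence, this is the order by decreasing imaginary part.\<close>

definition skew_eigenvalue :: "nat \<Rightarrow> (nat \<Rightarrow> 'a) \<Rightarrow> nat \<Rightarrow> 'a::comm_ring_1" where
  "skew_eigenvalue n z k =
    (if k < n div 2 then z k else if n - 1 - k < n div 2 then - z (n - 1 - k) else 0)"

lemma mset_skew_eigenvalues:
  "mset (map (skew_eigenvalue n z) [0..<n]) =
     mset (map z [0..<n div 2]) + mset (map (\<lambda>q. - z q) [0..<n div 2]) + mset (replicate (n mod 2) 0)"
proof -
  define m where "m = n div 2"
  define r where "r = n mod 2"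
  have n: "n = m + r + m" unfolding m_def r_def by presburger
  have r: "r < 2" by (simp add: r_def)
  have "[0..<n] = [0..<m] @ [m..<m + r] @ [m + r..<n]"
    using upt_add_eq_append[of 0 m "r + m"] upt_add_eq_append[of m "m + r" m] by (simp add: n add.assoc)
  then have "map (skew_eigenvalue n z) [0..<n] = map (skew_eigenvalue n z) [0..<m] @
      map (skew_eigenvalue n z) [m..<m + r] @ map (skew_eigenvalue n z) [m + r..<n]"
    by (simp only: map_append)
  also have "map (skew_eigenvalue n z) [0..<m] = map z [0..<m]"
    by (simp add: skew_eigenvalue_def m_def)
  also have "map (skew_eigenvalue n z) [m..<m + r] = replicate r 0"
    using r by (intro nth_equalityI) (auto simp: skew_eigenvalue_def m_def[symmetric] n)
  also have "map (skew_eigenvalue n z) [m + r..<n] = rev (map (\<lambda>q. - z q) [0..<m])"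
    by (intro nth_equalityI) (auto simp: skew_eigenvalue_def m_def[symmetric] n rev_nth)
  finally show ?thesis unfolding m_def[symmetric] r_def[symmetric] by simp
qed

text \<open>Each \<open>z q\<close> is paired with its negative. With \<open>z q\<close> equal to i
  times \<open>l q\<close>, the right-hand side is the characteristic polynomial of
  \<open>skew_diag n l\<close>.\<close>

lemma prod_skew_eigenvalues:
  "(\<Prod>k<n. [:- skew_eigenvalue n z k, 1:]) = (\<Prod>q<n div 2. [:- (z q ^ 2), 0, 1:]) * [:0, 1:] ^ (n mod 2)"
proof -
  have prod_mset: "(\<Prod>k<m. f (g k)) = prod_mset (image_mset f (mset (map g [0..<m])))"
    for m and g :: "nat \<Rightarrow> 'a" and f :: "'a \<Rightarrow> 'a poly"
    by (simp add: prod_mset_prod_list prod.list_conv_set_nth lessThan_atLeast0 flip: mset_map)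
  have "(\<Prod>k<n. [:- skew_eigenvalue n z k, 1:]) =
      (\<Prod>q<n div 2. [:- z q, 1:]) * (\<Prod>q<n div 2. [:- (- z q), 1:]) * [:0, 1:] ^ (n mod 2)"
    unfolding prod_mset[where f = "\<lambda>x. [:- x, 1:]"] mset_skew_eigenvalues by simp
  also have "(\<Prod>q<n div 2. [:- z q, 1:]) * (\<Prod>q<n div 2. [:- (- z q), 1:]) =
      (\<Prod>q<n div 2. [:- (z q ^ 2), 0, 1:])"
    unfolding prod.distrib[symmetric] by (simp add: power2_eq_square)
  finally show ?thesis .
qed

text \<open>The factorization holds at each \<epsilon> by the choice of the eigenvalues, and
  polynomial nets have unique classes. Such a factorization need not be unique, which is why the
  sorted comparison is required.\<close>

lemma distinguished_tuple_prod:
  assumes A: "A \<in> carrier_mat n n" and M: "mat_represents n M A"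
    and es: "\<And>\<epsilon>. \<epsilon> \<in> {0<..1} \<Longrightarrow> ordered_eigenvalues (M \<epsilon>) (es \<epsilon>)"
    and \<theta>: "\<And>k. k < n \<Longrightarrow> represents (\<lambda>\<epsilon>. es \<epsilon> ! k) (\<theta> k)"
  shows "char_poly (map_mat complex_of_colombeau A) = (\<Prod>k<n. [:- \<theta> k, 1:])"
proof (rule poly_represents_unique)
  show "poly_represents (\<lambda>\<epsilon>. char_poly (map_mat complex_of_real (M \<epsilon>))) (char_poly (map_mat complex_of_colombeau A))"
    using A by (intro poly_represents_char_poly[of _ n] mat_represents_complex M) auto
  have "poly_represents (\<lambda>\<epsilon>. \<Prod>k<n. [:- (es \<epsilon> ! k), 1:]) (\<Prod>k<n. [:- \<theta> k, 1:])"
    by (intro poly_represents_prod poly_represents_linear_factor \<theta>) simp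
  then show "poly_represents (\<lambda>\<epsilon>. char_poly (map_mat complex_of_real (M \<epsilon>))) (\<Prod>k<n. [:- \<theta> k, 1:])"
  proof (rule poly_represents_cong_unit)
    fix \<epsilon> :: real assume \<epsilon>: "\<epsilon> \<in> {0<..1}"
    then have "M \<epsilon> \<in> carrier_mat n n" using M by (simp add: mat_represents_def)
    then have "length (es \<epsilon>) = n" using es[OF \<epsilon>] by (rule ordered_eigenvalues_length)
    then show "char_poly (map_mat complex_of_real (M \<epsilon>)) = (\<Prod>k<n. [:- (es \<epsilon> ! k), 1:])"
      using es[OF \<epsilon>] by (simp add: ordered_eigenvalues_def prod.list_conv_set_nth lessThan_atLeast0)
  qed
qed

lemma char_poly_real_skew:
  fixes S V :: "real mat"
  assumes S: "S \<in> carrier_mat n n" and V: "V \<in> carrier_mat n n" "transpose_mat V * V = 1\<^sub>m n"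
    and D: "transpose_mat V * S * V = skew_diag n l"
  shows "char_poly (map_mat complex_of_real S) = (\<Prod>k<n. [:- skew_eigenvalue n (\<lambda>q. \<i> * complex_of_real (l q)) k, 1:])"
proof -
  have "char_poly S = char_poly (skew_diag n l)"
    using char_poly_similar[OF orthogonal_congruence_similar[OF S V]] D by simp
  then have "char_poly (map_mat complex_of_real S) = char_poly (map_mat complex_of_real (skew_diag n l))"
    by (simp add: of_real_hom.char_poly_hom[of _ n] S)
  also have "map_mat complex_of_real (skew_diag n l) = skew_diag n (\<lambda>q. complex_of_real (l q))"
    by (rule eq_matI) auto
  finally show ?thesis unfolding char_poly_skew_diag prod_skew_eigenvalues
    by (simp add: power_mult_distrib)
qed

text \<open>The net \<open>l\<close> is kept beside the classes \<open>d q\<close>: order, vanishing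
  of later entries and square roots are all obtained from its pointwise monotonicity and
  nonnegativity.\<close>

lemma skew_colombeau_normal_form:
  fixes A :: "real colombeau mat"
  assumes A: "A \<in> carrier_mat n n" "transpose_mat A = - A" and dist: "distinguished_tuple n A \<theta>s"
  obtains V d l where "V \<in> carrier_mat n n" "transpose_mat V * V = 1\<^sub>m n" "V * transpose_mat V = 1\<^sub>m n"
    "transpose_mat V * A * V = skew_diag n d"
    "\<And>q. q < n div 2 \<Longrightarrow> represents (\<lambda>\<epsilon>. l \<epsilon> q) (d q)"
    "\<And>\<epsilon>. antimono (l \<epsilon>)" "\<And>\<epsilon> q. 0 \<le> l \<epsilon> q"
    "\<And>k. k < n \<Longrightarrow> \<theta>s ! k = skew_eigenvalue n (\<lambda>q. colombeau_const \<i> * complex_of_colombeau (d q)) k"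
proof -
  obtain S where S: "mat_represents n S A" "\<And>\<epsilon>. S \<epsilon> \<in> carrier_mat n n" "\<And>\<epsilon>. transpose_mat (S \<epsilon>) = - S \<epsilon>"
    using skew_representative[OF A] by blast
  have "\<forall>\<epsilon>. \<exists>V l. V \<in> carrier_mat n n \<and> transpose_mat V * V = 1\<^sub>m n \<and>
      transpose_mat V * S \<epsilon> * V = skew_diag n l \<and> antimono l \<and> (\<forall>q. 0 \<le> l q) \<and> (\<forall>q\<ge>n div 2. l q = 0)"
    using real_skew_normal_form[OF S(2,3)] by blast
  then obtain V l where V: "\<And>\<epsilon>. V \<epsilon> \<in> carrier_mat n n" "\<And>\<epsilon>. transpose_mat (V \<epsilon>) * V \<epsilon> = 1\<^sub>m n"
    and VS: "\<And>\<epsilon>. transpose_mat (V \<epsilon>) * S \<epsilon> * V \<epsilon> = skew_diag n (l \<epsilon>)"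
    and l: "\<And>\<epsilon>. antimono (l \<epsilon>)" "\<And>\<epsilon> q. 0 \<le> l \<epsilon> q"
    by metis
  \<comment> \<open>The right inverse is obtained over the reals at each \<epsilon>; both identities
    are then transferred to the class \<open>W\<close>.\<close>
  have V': "V \<epsilon> * transpose_mat (V \<epsilon>) = 1\<^sub>m n" for \<epsilon>
    by (rule mat_mult_left_right_inverse[OF _ V]) (use V(1)[of \<epsilon>] in simp)
  define W where "W = mat n n (\<lambda>(i, j). abs_colombeau (\<lambda>\<epsilon>. V \<epsilon> $$ (i, j)))"
  have W: "W \<in> carrier_mat n n" by (simp add: W_def)
  have repW: "mat_represents n V W"
    unfolding mat_represents_def
  proof (intro conjI ballI allI impI)
    fix i j assume ij: "i < n" "j < n"
    have "moderate (\<lambda>\<epsilon>. V \<epsilon> $$ (i, j))"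
      by (rule moderate_norm_le[OF moderate_const[of "1 :: real"]])
        (use orthogonal_entry_le_1[OF V ij] in simp)
    then show "represents (\<lambda>\<epsilon>. V \<epsilon> $$ (i, j)) (W $$ (i, j))"
      using ij by (simp add: W_def represents_abs)
  qed (rule V)
  have Wt: "transpose_mat W \<in> carrier_mat n n" "mat_represents n (\<lambda>\<epsilon>. transpose_mat (V \<epsilon>)) (transpose_mat W)"
    using W mat_represents_transpose[OF W repW] by auto
  have WW: "transpose_mat W * W = 1\<^sub>m n" "W * transpose_mat W = 1\<^sub>m n"
    by (rule mat_represents_orthogonal[OF Wt W repW V(2)], rule mat_represents_orthogonal[OF W repW Wt V'])
  let ?D = "transpose_mat W * A * W"
  have D: "?D \<in> carrier_mat n n" using W A by simp
  have "mat_represents n (\<lambda>\<epsilon>. transpose_mat (V \<epsilon>) * S \<epsilon> * V \<epsilon>) ?D"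
    by (rule mat_represents_mult[OF mult_carrier_mat[OF Wt(1) A(1)] mat_represents_mult[OF Wt A(1) S(1)] W repW])
  then have repD: "mat_represents n (\<lambda>\<epsilon>. skew_diag n (l \<epsilon>)) ?D" unfolding VS .
  \<comment> \<open>The lower left entry of block \<open>q\<close>. Reading it off the transformed
    matrix gives moderateness of \<open>l\<close> without a separate eigenvalue bound.\<close>
  define d where "d q = ?D $$ (2 * q + 1, 2 * q)" for q
  have d: "represents (\<lambda>\<epsilon>. l \<epsilon> q) (d q)" if "q < n div 2" for q
  proof -
    have q: "2 * q + 1 < n" "2 * q < n" using that by auto
    have "represents (\<lambda>\<epsilon>. skew_diag n (l \<epsilon>) $$ (2 * q + 1, 2 * q)) (?D $$ (2 * q + 1, 2 * q))"
      using repD q unfolding mat_represents_def by blast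
    then show ?thesis using q by (simp add: d_def del: index_mult_mat)
  qed
  have D_eq: "?D = skew_diag n d"
  proof (rule mat_represents_eqI[OF D skew_diag_carrier repD])
    fix i j assume ij: "i < n" "j < n"
    show "represents (\<lambda>\<epsilon>. skew_diag n (l \<epsilon>) $$ (i, j)) (skew_diag n d $$ (i, j))"
      using ij by (auto intro!: represents_0 represents_uminus d)
  qed
  have "length \<theta>s = n" using dist by (simp add: distinguished_tuple_def)
  obtain M es where M: "mat_represents n M A"
    and es: "\<And>\<epsilon>. \<epsilon> \<in> {0<..1} \<Longrightarrow> ordered_eigenvalues (M \<epsilon>) (es \<epsilon>)"
    and \<theta>: "\<And>k. k < n \<Longrightarrow> represents (\<lambda>\<epsilon>. es \<epsilon> ! k) (\<theta>s ! k)"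
    using dist unfolding distinguished_tuple_def by blast
  let ?b = "\<lambda>k \<epsilon>. skew_eigenvalue n (\<lambda>q. \<i> * complex_of_real (l \<epsilon> q)) k"
  let ?\<beta> = "skew_eigenvalue n (\<lambda>q. colombeau_const \<i> * complex_of_colombeau (d q))"
  have b: "represents (?b k) (?\<beta> k)" for k
    unfolding skew_eigenvalue_def
    by (auto intro!: represents_0 represents_uminus represents_mult represents_const
        represents_complex_of_colombeau d)
  have "char_poly (map_mat complex_of_colombeau A) = (\<Prod>k<n. [:- ?\<beta> k, 1:])"
  proof (rule poly_represents_unique)
    show "poly_represents (\<lambda>\<epsilon>. char_poly (map_mat complex_of_real (S \<epsilon>))) (char_poly (map_mat complex_of_colombeau A))"
      using A by (intro poly_represents_char_poly[of _ n] mat_represents_complex S) auto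
    show "poly_represents (\<lambda>\<epsilon>. char_poly (map_mat complex_of_real (S \<epsilon>))) (\<Prod>k<n. [:- ?\<beta> k, 1:])"
      unfolding char_poly_real_skew[OF S(2) V VS]
      by (intro poly_represents_prod poly_represents_linear_factor b)
  qed
  moreover have "char_poly (map_mat complex_of_colombeau A) = (\<Prod>k<n. [:- (\<theta>s ! k), 1:])"
    by (rule distinguished_tuple_prod[OF A(1) M es \<theta>])
  ultimately have eq: "(\<Prod>k<n. [:- (\<theta>s ! k), 1:]) = (\<Prod>k<n. [:- ?\<beta> k, 1:])" by simp
  have "\<theta>s ! k = ?\<beta> k" if k: "k < n" for k
  proof (rule sorted_roots_unique[OF \<theta> b eq _ _ _ k])
    fix \<epsilon> :: real and i j assume \<epsilon>: "\<epsilon> \<in> {0<..1}" and ij: "i \<le> j" "j < n"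
    have "M \<epsilon> \<in> carrier_mat n n" using M \<epsilon> by (simp add: mat_represents_def)
    then have "length (es \<epsilon>) = n" using es[OF \<epsilon>] by (rule ordered_eigenvalues_length)
    then show "Im (es \<epsilon> ! j) \<le> Im (es \<epsilon> ! i)"
      using es[OF \<epsilon>] ij by (cases "i = j") (auto simp: ordered_eigenvalues_def sorted_wrt_iff_nth_less)
    \<comment> \<open>Within the first half \<open>l\<close> decreases; within the second half the
      mirrored index and the sign both reverse the order; across the halves only the sign
      matters.\<close>
    have "l \<epsilon> j \<le> l \<epsilon> i" "n - 1 - j \<le> n - 1 - i" using antimonoD[OF l(1) ij(1)] ij by auto
    moreover from this have "l \<epsilon> (n - 1 - i) \<le> l \<epsilon> (n - 1 - j)" by (intro antimonoD[OF l(1)])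
    moreover have "- l \<epsilon> p \<le> l \<epsilon> q" for p q using l(2)[of \<epsilon> p] l(2)[of \<epsilon> q] by linarith
    ultimately show "Im (?b j \<epsilon>) \<le> Im (?b i \<epsilon>)"
      using ij l(2)[of \<epsilon>] by (auto simp: skew_eigenvalue_def)
  qed (auto simp: skew_eigenvalue_def)
  then show thesis
    using that[OF W WW D_eq d l] by blast
qed

section \<open>Block matrices built from lists\<close>

lemma rotation_block_eq: "rotation_block x = skew_diag 2 (\<lambda>_. x)"
  by (rule eq_matI) (auto simp: rotation_block_def mat_of_rows_list_def less_2_cases_iff)

lemma diag_block_mat_zero_blocks: "diag_block_mat (replicate r (0\<^sub>m 1 1)) = (0\<^sub>m r r :: 'a::zero mat)"
  by (induction r) (auto intro!: eq_matI)

lemma diag_block_rotations: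
  "diag_block_mat (map rotation_block ls @ replicate r (0\<^sub>m 1 1)) =
     skew_diag (2 * length ls + r) (\<lambda>q. if q < length ls then ls ! q else 0)"
proof (induction ls)
  case Nil
  show ?case by (rule eq_matI) (simp_all add: diag_block_mat_zero_blocks[unfolded One_nat_def])
next
  case (Cons x ls)
  show ?case
    unfolding list.map append.simps diag_block_mat.simps Cons Let_def
    by (simp add: rotation_block_eq skew_diag_Suc_Suc cong: if_cong)
qed

section \<open>Invertibility and non-degeneracy\<close>

text \<open>If \<open>r\<close> is not bounded below by any power of \<open>\<epsilon>\<close>, it is annihilated by the
  indicator function of a sequence of points \<open>e k\<close> tending to \<open>0\<close> with \<open>norm (r (e k)) < (e k)\<^sup>k\<close>.\<close>

lemma colombeau_non_unit_annihilator:
  fixes x :: "'a::real_normed_field colombeau"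
  assumes "\<not> x dvd 1"
  obtains c where "c \<noteq> 0" "c * x = 0"
proof -
  define r where "r = rep_colombeau x"
  have r: "represents r x" by (simp add: r_def represents_rep)
  \<comment> \<open>A lower bound by a power of \<epsilon> would make the pointwise inverse moderate
    and \<open>x\<close> a unit.\<close>
  have freq: "\<not> eventually (\<lambda>\<epsilon>. \<epsilon> ^ N \<le> norm (r \<epsilon>)) (at_right 0)" for N
  proof
    assume ev: "eventually (\<lambda>\<epsilon>. \<epsilon> ^ N \<le> norm (r \<epsilon>)) (at_right 0)"
    have "moderate (\<lambda>\<epsilon>. inverse (r \<epsilon>))"
      unfolding moderate_def
    proof (intro exI[of _ N] landau_o.big_mono)
      show "eventually (\<lambda>\<epsilon>. norm (norm (inverse (r \<epsilon>))) \<le> norm ((1 / \<epsilon>) ^ N)) (at_right 0)"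
        using ev eventually_at_right_unit
      proof eventually_elim
        case (elim \<epsilon>)
        then have "inverse (norm (r \<epsilon>)) \<le> inverse (\<epsilon> ^ N)" by (intro le_imp_inverse_le) auto
        with elim show ?case by (simp add: norm_inverse norm_divide power_one_over inverse_eq_divide)
      qed
    qed
    then have "represents (\<lambda>\<epsilon>. r \<epsilon> * inverse (r \<epsilon>)) (x * abs_colombeau (\<lambda>\<epsilon>. inverse (r \<epsilon>)))"
      by (intro represents_mult r represents_abs)
    moreover have "eventually (\<lambda>\<epsilon>. 1 = r \<epsilon> * inverse (r \<epsilon>)) (at_right 0)"
      using ev eventually_at_right_unit
    proof eventually_elim
      case (elim \<epsilon>)
      then have "0 < \<epsilon> ^ N" by simp
      then have "r \<epsilon> \<noteq> 0" using elim(1) by auto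
      then show ?case by simp
    qed
    ultimately have "represents (\<lambda>_. 1) (x * abs_colombeau (\<lambda>\<epsilon>. inverse (r \<epsilon>)))"
      by (rule represents_cong)
    then have "x * abs_colombeau (\<lambda>\<epsilon>. inverse (r \<epsilon>)) = 1" using represents_1 represents_unique by blast
    then have "x dvd 1" by (metis dvd_triv_left)
    with assms show False ..
  qed
  have "\<exists>\<epsilon>>0. \<epsilon> < 1 / Suc k \<and> norm (r \<epsilon>) < \<epsilon> ^ k" for k
  proof (rule ccontr)
    assume none: "\<not> ?thesis"
    have "eventually (\<lambda>\<epsilon>::real. \<epsilon> \<in> {0<..<1 / Suc k}) (at_right 0)"
      by (intro eventually_at_right_real) simp
    then have "eventually (\<lambda>\<epsilon>. \<epsilon> ^ k \<le> norm (r \<epsilon>)) (at_right 0)"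
      by eventually_elim (use none in force)
    with freq show False by blast
  qed
  then obtain e where e: "\<And>k. 0 < e k" "\<And>k. e k < 1 / Suc k" "\<And>k. norm (r (e k)) < e k ^ k" by metis
  define c :: "real \<Rightarrow> 'a" where "c \<epsilon> = (if \<epsilon> \<in> range e then 1 else 0)" for \<epsilon>
  have c: "moderate c"
    by (rule moderate_norm_le[OF moderate_const[of 1]]) (simp add: c_def)
  \<comment> \<open>Points of the sequence \<open>e\<close>, where \<open>c\<close> equals 1, occur
    arbitrarily close to 0.\<close>
  have "\<not> negligible_net c"
  proof
    assume "negligible_net c"
    then have "(\<lambda>\<epsilon>. norm (c \<epsilon>)) \<in> O[at_right 0](\<lambda>\<epsilon>. \<epsilon> ^ 1)" unfolding negligible_net_def by blast
    then obtain C where "C > 0" "eventually (\<lambda>\<epsilon>. norm (norm (c \<epsilon>)) \<le> C * norm (\<epsilon> ^ 1)) (at_right 0)"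
      by (elim landau_o.bigE)
    then obtain d where d: "d > 0" "\<And>\<epsilon>. 0 < \<epsilon> \<Longrightarrow> \<epsilon> < d \<Longrightarrow> norm (c \<epsilon>) \<le> C * \<epsilon>"
      unfolding eventually_at_right_field by (auto simp: abs_of_pos)
    obtain k where k: "1 / real (Suc k) < min d (1 / C)"
      using nat_approx_posE[of "min d (1 / C)"] d(1) \<open>C > 0\<close> by auto
    then have "e k < d" "e k < 1 / C" using e(2)[of k] by auto
    then have "1 \<le> C * e k" using d(2)[OF e(1)[of k]] by (simp add: c_def)
    with \<open>e k < 1 / C\<close> \<open>C > 0\<close> show False by (simp add: field_simps)
  qed
  moreover have "negligible_net (\<lambda>\<epsilon>. c \<epsilon> * r \<epsilon>)"
    unfolding negligible_net_def
  proof (intro allI landau_o.big_mono)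
    fix m :: nat
    \<comment> \<open>Below \<open>d\<close> only the points \<open>e k\<close> with
      \<open>m \<le> k\<close> occur, and there \<open>r\<close> is smaller than the
      \<open>m\<close>-th power of \<epsilon>. The inserted 1 keeps \<epsilon> below 1 and the set
      nonempty.\<close>
    define d where "d = Min (insert 1 (e ` {..<m}))"
    have "d > 0" unfolding d_def using e(1) by (subst Min_gr_iff) auto
    then have "eventually (\<lambda>\<epsilon>::real. \<epsilon> \<in> {0<..<d}) (at_right 0)" by (rule eventually_at_right_real)
    then show "eventually (\<lambda>\<epsilon>. norm (norm (c \<epsilon> * r \<epsilon>)) \<le> norm (\<epsilon> ^ m)) (at_right 0)"
    proof eventually_elim
      case (elim \<epsilon>)
      show ?case
      proof (cases "\<epsilon> \<in> range e")
        case True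
        then obtain k where k: "\<epsilon> = e k" by blast
        have "d \<le> 1" unfolding d_def by (intro Min_le) auto
        have "m \<le> k"
        proof (rule ccontr)
          assume "\<not> m \<le> k"
          then have "d \<le> e k" unfolding d_def by (intro Min_le) auto
          with elim k show False by simp
        qed
        have "norm (r \<epsilon>) \<le> \<epsilon> ^ k" using e(3)[of k] k by simp
        also have "\<dots> \<le> \<epsilon> ^ m" using elim \<open>d \<le> 1\<close> \<open>m \<le> k\<close> by (intro power_decreasing) auto
        finally show ?thesis using True elim by (simp add: c_def)
      qed (simp add: c_def)
    qed
  qed
  ultimately show thesis
    using that[of "abs_colombeau c"] represents_eq_0_iff[OF represents_abs[OF c]]
      represents_eq_0_iff[OF represents_mult[OF represents_abs[OF c] r]] by blast
qed

text \<open>For small \<epsilon> the product of \<open>l\<close> with a representative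
  \<open>s\<close> of the inverse is at least 1/2. So \<open>l\<close> is positive and its
  reciprocal is at most \<open>2 * s\<close>, which makes the reciprocal root moderate.\<close>

lemma colombeau_unit_inverse_sqrt:
  fixes x :: "real colombeau"
  assumes l: "represents l x" and nonneg: "\<And>\<epsilon>. 0 \<le> l \<epsilon>" and unit: "x dvd 1"
  obtains c where "c * c * x = 1"
proof -
  obtain y where "1 = x * y" using unit by (rule dvdE)
  define s where "s = rep_colombeau y"
  have s: "represents s y" by (simp add: s_def represents_rep)
  have "negligible_net (\<lambda>\<epsilon>. l \<epsilon> * s \<epsilon> - 1)"
    using represents_eq_iff[OF represents_mult[OF l s] represents_1] \<open>1 = x * y\<close> by simp
  then have "(\<lambda>\<epsilon>. norm (l \<epsilon> * s \<epsilon> - 1)) \<in> O[at_right 0](\<lambda>\<epsilon>. \<epsilon> ^ 1)"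
    unfolding negligible_net_def by blast
  then obtain C where C: "C > 0" "eventually (\<lambda>\<epsilon>. norm (norm (l \<epsilon> * s \<epsilon> - 1)) \<le> C * norm (\<epsilon> ^ 1)) (at_right 0)"
    by (elim landau_o.bigE)
  have "eventually (\<lambda>\<epsilon>::real. \<epsilon> \<in> {0<..<1 / (2 * C)}) (at_right 0)"
    using C(1) by (intro eventually_at_right_real) simp
  then have ev: "eventually (\<lambda>\<epsilon>. 0 < l \<epsilon> \<and> 1 / l \<epsilon> \<le> 2 * s \<epsilon>) (at_right 0)"
    using C(2)
  proof eventually_elim
    case (elim \<epsilon>)
    then have "C * \<epsilon> < 1 / 2" using C(1) by (simp add: field_simps)
    then have half: "1 / 2 \<le> l \<epsilon> * s \<epsilon>" using elim by (simp add: abs_le_iff)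
    then have "l \<epsilon> \<noteq> 0" by auto
    then have "0 < l \<epsilon>" using nonneg[of \<epsilon>] by simp
    then show ?case using half by (simp add: field_simps)
  qed
  define c where "c \<epsilon> = 1 / sqrt (l \<epsilon>)" for \<epsilon>
  have "moderate (\<lambda>\<epsilon>. 1 + 2 * s \<epsilon>)"
    using s by (intro moderate_add moderate_mult moderate_const) (simp add: represents_def)
  then have "moderate c"
  proof (rule moderate_norm_le)
    show "eventually (\<lambda>\<epsilon>. norm (c \<epsilon>) \<le> norm (1 + 2 * s \<epsilon>)) (at_right 0)"
      using ev
    proof eventually_elim
      case (elim \<epsilon>)
      have "c \<epsilon> * c \<epsilon> = 1 / l \<epsilon>" using nonneg[of \<epsilon>] by (simp add: c_def)
      \<comment> \<open>Bounding the root by its square reduces moderateness to that of the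
        reciprocal of \<open>l\<close>.\<close>
      moreover have "c \<epsilon> \<le> 1 + c \<epsilon> * c \<epsilon>"
        using zero_le_square[of "c \<epsilon> - 1 / 2"] by (simp add: field_simps)
      moreover have "0 \<le> c \<epsilon>" using nonneg[of \<epsilon>] by (simp add: c_def)
      ultimately show ?case using elim by simp
    qed
  qed
  then have "represents (\<lambda>\<epsilon>. c \<epsilon> * c \<epsilon> * l \<epsilon>) (abs_colombeau c * abs_colombeau c * x)"
    by (intro represents_mult represents_abs l)
  then have "represents (\<lambda>_. 1) (abs_colombeau c * abs_colombeau c * x)"
    by (rule represents_cong) (use ev in \<open>auto elim!: eventually_mono simp: c_def field_simps\<close>)
  then show thesis using that represents_1 represents_unique by blast
qed

section \<open>Criteria for non-degeneracy and degeneracy\<close>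

text \<open>The columns of the adjugate serve as test vectors: \<open>A\<close> maps them to
  \<open>det A\<close> times the unit vectors, which isolates the coordinates of \<open>x\<close> up
  to a unit.\<close>

lemma nondegenerate_if_det_unit:
  assumes A: "A \<in> carrier_mat n n" and unit: "det A dvd 1"
  shows "nondegenerate n A"
  unfolding nondegenerate_def
proof (intro ballI impI)
  fix x assume x: "x \<in> carrier_vec n" and 0: "\<forall>y\<in>carrier_vec n. x \<bullet> (A *\<^sub>v y) = 0"
  obtain u where u: "1 = det A * u" using unit by (rule dvdE)
  show "x = 0\<^sub>v n"
  proof (rule eq_vecI)
    fix i assume "i < dim_vec (0\<^sub>v n :: real colombeau vec)"
    then have i: "i < n" by simp
    define y where "y = col (adj_mat A) i"
    have y: "y \<in> carrier_vec n" using adj_mat(1)[OF A] i by (auto simp: y_def)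
    have "A *\<^sub>v y = col (A * adj_mat A) i"
      unfolding y_def by (rule col_mult2[OF A adj_mat(1)[OF A] i, symmetric])
    also have "\<dots> = det A \<cdot>\<^sub>v unit_vec n i"
      unfolding adj_mat(2)[OF A] using i by (intro eq_vecI) auto
    finally have "det A * x $ i = x \<bullet> (A *\<^sub>v y)" using x i by simp
    also have "\<dots> = 0" using 0 y by blast
    finally have "u * (det A * x $ i) = 0" by simp
    also have "u * (det A * x $ i) = x $ i" using u by (simp add: mult.assoc[symmetric] mult.commute)
    finally show "x $ i = 0\<^sub>v n $ i" using i by simp
  qed (use x in simp)
qed

text \<open>In the basis given by \<open>V\<close>, the vector \<open>c\<close> times column
  \<open>j\<close> is sent to an annihilated column, so it lies in the kernel of \<open>A\<close>.
  It is nonzero because its coordinate along column \<open>j\<close> is \<open>c\<close>.\<close>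

lemma degenerate_if_col_annihilated:
  assumes A: "A \<in> carrier_mat n n" "transpose_mat A = - A"
    and V: "V \<in> carrier_mat n n" "transpose_mat V * V = 1\<^sub>m n" "V * transpose_mat V = 1\<^sub>m n"
    and j: "j < n" and c: "c \<noteq> 0" "\<And>i. i < n \<Longrightarrow> c * (transpose_mat V * A * V) $$ (i, j) = 0"
  shows "\<not> nondegenerate n A"
proof
  assume nondeg: "nondegenerate n A"
  define x where "x = c \<cdot>\<^sub>v col V j"
  have x: "x \<in> carrier_vec n" using V j by (simp add: x_def)
  have "A *\<^sub>v x = (V * (transpose_mat V * A * V)) *\<^sub>v (c \<cdot>\<^sub>v unit_vec n j)"
  proof -
    have "V * (transpose_mat V * A * V) = V * (transpose_mat V * (A * V))" using A V by simp
    also have "\<dots> = V * transpose_mat V * (A * V)"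
      by (rule assoc_mult_mat[symmetric]) (use A V in auto)
    finally have eq: "V * (transpose_mat V * A * V) = A * V" unfolding V(3) using A V by simp
    have "V *\<^sub>v (c \<cdot>\<^sub>v unit_vec n j) = x"
      unfolding x_def using V(1) j by (intro eq_vecI) auto
    then show ?thesis unfolding eq by (simp add: assoc_mult_mat_vec[OF A(1) V(1)])
  qed
  also have "\<dots> = V *\<^sub>v ((transpose_mat V * A * V) *\<^sub>v (c \<cdot>\<^sub>v unit_vec n j))"
    using A V by (intro assoc_mult_mat_vec[of _ n n _ n]) auto
  also have "(transpose_mat V * A * V) *\<^sub>v (c \<cdot>\<^sub>v unit_vec n j) = 0\<^sub>v n"
  proof (rule eq_vecI)
    fix i assume "i < dim_vec (0\<^sub>v n :: real colombeau vec)"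
    then have i: "i < n" by simp
    have "((transpose_mat V * A * V) *\<^sub>v (c \<cdot>\<^sub>v unit_vec n j)) $ i = c * (row (transpose_mat V * A * V) i \<bullet> unit_vec n j)"
      using i A V by (simp del: index_mult_mat(1) row_mult assoc_mult_mat)
    also have "\<dots> = c * (transpose_mat V * A * V) $$ (i, j)"
      using i j A V by (simp del: index_mult_mat(1) row_mult assoc_mult_mat)
    finally show "((transpose_mat V * A * V) *\<^sub>v (c \<cdot>\<^sub>v unit_vec n j)) $ i = 0\<^sub>v n $ i"
      using c(2)[OF i] i by simp
  qed (use V in simp)
  finally have Ax: "A *\<^sub>v x = 0\<^sub>v n" using V by auto
  \<comment> \<open>Non-degeneracy tests \<open>x\<close> on the left; skewness moves the kernel
    property there.\<close>
  have "x \<bullet> (A *\<^sub>v y) = 0" if "y \<in> carrier_vec n" for y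
    using skew_scalar_prod[OF A x that] Ax that by simp
  then have "x = 0\<^sub>v n" using nondeg x unfolding nondegenerate_def by blast
  then have "transpose_mat V *\<^sub>v (c \<cdot>\<^sub>v col V j) = 0\<^sub>v n" using V by (auto simp: x_def)
  moreover have "(transpose_mat V *\<^sub>v (c \<cdot>\<^sub>v col V j)) $ j = c * (transpose_mat V * V) $$ (j, j)"
    using V(1) j by simp
  ultimately show False using j c(1) V(2) by simp
qed

section \<open>Reduction to the symplectic form\<close>

text \<open>Both columns of block \<open>q\<close> are scaled by \<open>c q\<close>, so the entries
  of the block become 1 and -1.\<close>

lemma symplectic_congruence:
  fixes A :: "'a::comm_ring_1 mat"
  assumes A: "A \<in> carrier_mat n n" and V: "V \<in> carrier_mat n n"
    and D: "transpose_mat V * A * V = skew_diag n d"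
    and n: "n = m + m" and c: "\<And>q. q < m \<Longrightarrow> c q * c q * d q = 1"
  obtains W where "W \<in> carrier_mat n n"
    "transpose_mat W * A * W = four_block_mat (0\<^sub>m m m) (- 1\<^sub>m m) (1\<^sub>m m) (0\<^sub>m m m)"
proof -
  \<comment> \<open>Column \<open>j\<close> of \<open>V * P\<close> is a multiple of column \<open>\<sigma> j\<close> of \<open>V\<close>: first the even, then the odd columns.\<close>
  define \<sigma> where "\<sigma> j = (if j < m then 2 * j else 2 * (j - m) + 1)" for j
  define b where "b j = (if j < m then c j else c (j - m))" for j
  define P where "P = mat n n (\<lambda>(i, j). if i = \<sigma> j then b j else 0)"
  have P: "P \<in> carrier_mat n n" by (simp add: P_def)
  have \<sigma>: "\<sigma> j < n" if "j < n" for j using that by (auto simp: \<sigma>_def n)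
  have "transpose_mat (V * P) * A * (V * P) = transpose_mat P * skew_diag n d * P"
    unfolding D[symmetric] by (rule congruence_mult[OF A V P])
  also have "\<dots> = four_block_mat (0\<^sub>m m m) (- 1\<^sub>m m) (1\<^sub>m m) (0\<^sub>m m m)"
  proof (rule eq_matI)
    fix i j
    assume "i < dim_row (four_block_mat (0\<^sub>m m m) (- 1\<^sub>m m) (1\<^sub>m m) (0\<^sub>m m m :: 'a mat))"
      and "j < dim_col (four_block_mat (0\<^sub>m m m) (- 1\<^sub>m m) (1\<^sub>m m) (0\<^sub>m m m :: 'a mat))"
    then have ij: "i < n" "j < n" by (auto simp: n)
    have col: "x \<bullet> col P k = x $ \<sigma> k * b k" if "x \<in> carrier_vec n" "k < n" for x k
    proof -
      have "x \<bullet> col P k = (\<Sum>l\<in>{0..<n}. if l = \<sigma> k then x $ l * b k else 0)"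
        using that unfolding scalar_prod_def by (intro sum.cong) (auto simp: P_def)
      then show ?thesis using \<sigma>[OF that(2)] by simp
    qed
    have colP: "col P k \<in> carrier_vec n" if "k < n" for k using P that by auto
    have Dcol: "skew_diag n d *\<^sub>v col P j \<in> carrier_vec n" 
      by (rule mult_mat_vec_carrier[OF skew_diag_carrier colP[OF ij(2)]])
    have "(transpose_mat P * skew_diag n d * P) $$ (i, j) = col P i \<bullet> (skew_diag n d *\<^sub>v col P j)"
      using ij P by (intro congruence_entries[of _ n n]) auto
    also have "\<dots> = (skew_diag n d *\<^sub>v col P j) \<bullet> col P i"
      by (rule comm_scalar_prod[OF colP[OF ij(1)] Dcol])
    also have "\<dots> = (skew_diag n d *\<^sub>v col P j) $ \<sigma> i * b i" by (rule col[OF Dcol ij(1)])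
    also have "(skew_diag n d *\<^sub>v col P j) $ \<sigma> i = row (skew_diag n d) (\<sigma> i) \<bullet> col P j"
      using \<sigma>[OF ij(1)] by simp
    also have "\<dots> = skew_diag n d $$ (\<sigma> i, \<sigma> j) * b j"
      using \<sigma>[OF ij(1)] \<sigma>[OF ij(2)] ij by (subst col) auto
    finally have entry: "(transpose_mat P * skew_diag n d * P) $$ (i, j) = skew_diag n d $$ (\<sigma> i, \<sigma> j) * b j * b i" .
    \<comment> \<open>\<open>\<sigma>\<close> maps each half to indices of one parity, while nonzero
      entries of \<open>skew_diag\<close> join indices of opposite parity. This empties the diagonal
      blocks.\<close>
    have par: "2 * p \<noteq> Suc (2 * q)" "Suc (2 * p) \<noteq> 2 * q" for p q :: nat by presburger+
    consider "i < m" "j < m" | "i < m" "j \<ge> m" | "i \<ge> m" "j < m" | "i \<ge> m" "j \<ge> m" by linarith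
    then show "(transpose_mat P * skew_diag n d * P) $$ (i, j) =
        four_block_mat (0\<^sub>m m m) (- 1\<^sub>m m) (1\<^sub>m m) (0\<^sub>m m m) $$ (i, j)"
    proof cases
      case 1
      then show ?thesis using ij \<sigma>[OF ij(1)] \<sigma>[OF ij(2)] unfolding entry by (auto simp: \<sigma>_def par n)
    next
      case 2
      then show ?thesis using ij \<sigma>[OF ij(1)] \<sigma>[OF ij(2)] c[of i] unfolding entry
        by (auto simp: \<sigma>_def b_def n mult_ac)
    next
      case 3
      then show ?thesis using ij \<sigma>[OF ij(1)] \<sigma>[OF ij(2)] c[of j] unfolding entry
        by (auto simp: \<sigma>_def b_def n mult_ac)
    next
      case 4
      then show ?thesis using ij \<sigma>[OF ij(1)] \<sigma>[OF ij(2)] unfolding entry by (auto simp: \<sigma>_def par n)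
    qed
  qed (simp_all add: P_def n)
  finally show thesis using that[of "V * P"] V P by simp
qed

text \<open>The symplectic matrix is orthogonal, so its determinant is a unit without being
  computed.\<close>

lemma det_symplectic_unit:
  "det (four_block_mat (0\<^sub>m m m) (- 1\<^sub>m m) (1\<^sub>m m) (0\<^sub>m m m) :: 'a::comm_ring_1 mat) dvd 1"
proof -
  let ?J = "four_block_mat (0\<^sub>m m m) (- 1\<^sub>m m) (1\<^sub>m m) (0\<^sub>m m m) :: 'a mat"
  have J: "?J \<in> carrier_mat (m + m) (m + m)" by simp
  have "transpose_mat ?J = four_block_mat (0\<^sub>m m m) (1\<^sub>m m) (- 1\<^sub>m m) (0\<^sub>m m m)"
    by (subst transpose_four_block_mat[of _ m m _ m _ m]) (auto simp: transpose_uminus)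
  moreover have "- 0\<^sub>m m m = (0\<^sub>m m m :: 'a mat)" by (rule eq_matI) auto
  ultimately have "?J * transpose_mat ?J = 1\<^sub>m (m + m)"
    by (simp add: mult_four_block_mat[of _ m m _ m _ m _ _ m _ m])
  then have "det ?J * det (transpose_mat ?J) = 1"
    by (metis J det_mult det_one transpose_carrier_mat)
  then show ?thesis by (metis dvd_triv_left)
qed

text \<open>If \<open>x\<close> is not a unit, some nonzero real \<open>c\<close> annihilates it,
  hence also its complex multiple, which therefore cannot be a unit. Conversely, i has the inverse
  -i.\<close>

lemma imaginary_multiple_unit_iff:
  "colombeau_const \<i> * complex_of_colombeau x dvd 1 \<longleftrightarrow> x dvd 1"
proof
  assume unit: "colombeau_const \<i> * complex_of_colombeau x dvd 1"
  show "x dvd 1"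
  proof (rule ccontr)
    assume "\<not> x dvd 1"
    then obtain c where c: "c \<noteq> 0" "c * x = 0" by (rule colombeau_non_unit_annihilator)
    obtain y where y: "1 = colombeau_const \<i> * complex_of_colombeau x * y" using unit by (rule dvdE)
    have "complex_of_colombeau c = complex_of_colombeau c * (colombeau_const \<i> * complex_of_colombeau x * y)"
      by (simp flip: y)
    also have "\<dots> = complex_of_colombeau (c * x) * (colombeau_const \<i> * y)"
      by (simp add: complex_of_colombeau_hom mult_ac)
    also have "\<dots> = 0" by (simp add: c(2) complex_of_colombeau_hom)
    finally show False using c(1) by (simp add: complex_of_colombeau_eq_0_iff)
  qed
next
  assume "x dvd 1"
  then obtain y where y: "1 = x * y" by (rule dvdE)
  have ii: "colombeau_const \<i> * - colombeau_const \<i> = 1"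
    using represents_unique[OF represents_mult[OF represents_const represents_uminus[OF represents_const], of \<i> \<i>]]
      represents_1 by simp
  have "(colombeau_const \<i> * complex_of_colombeau x) * (- colombeau_const \<i> * complex_of_colombeau y) =
      (colombeau_const \<i> * - colombeau_const \<i>) * complex_of_colombeau (x * y)"
    by (simp add: complex_of_colombeau_hom mult_ac)
  also have "\<dots> = 1" by (simp only: ii y[symmetric] complex_of_colombeau_hom mult_1)
  finally show "colombeau_const \<i> * complex_of_colombeau x dvd 1" by (metis dvd_triv_left)
qed

lemma imaginary_multiple_eq_0_iff:
  "colombeau_const \<i> * complex_of_colombeau x = 0 \<longleftrightarrow> x = 0"
proof -
  have "colombeau_const \<i> * complex_of_colombeau x = 0 \<longleftrightarrow>
      negligible_net (\<lambda>\<epsilon>. \<i> * complex_of_real (rep_colombeau x \<epsilon>))"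
    by (intro represents_eq_0_iff represents_mult represents_const represents_complex_of_colombeau represents_rep)
  also have "\<dots> \<longleftrightarrow> x = 0"
    unfolding represents_eq_0_iff[OF represents_rep[of x]] by (simp add: negligible_net_def norm_mult)
  finally show ?thesis .
qed

section \<open>Assembly of both assertions\<close>

theorem theorem3p27:
  fixes A :: "real colombeau mat" and n :: nat and \<theta>s :: "complex colombeau list"
  assumes "A \<in> carrier_mat n n"
    and "transpose_mat A = - A"
    and "distinguished_tuple n A \<theta>s"
  shows "(\<exists>V ls. V \<in> carrier_mat n n \<and> transpose_mat V * V = 1\<^sub>m n \<and>
            2 * length ls \<le> n \<and>
            transpose_mat V * A * V =
              diag_block_mat (map rotation_block ls @ replicate (n - 2 * length ls) (0\<^sub>m 1 1)) \<and>
            sorted_wrt (\<ge>) ls \<and> (\<forall>l\<in>set ls. l \<ge> 0) \<and>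
            filter_mset (\<lambda>\<theta>. \<theta> \<noteq> 0) (mset \<theta>s) =
              mset (map (\<lambda>l. colombeau_const \<i> * complex_of_colombeau l) ls) +
              mset (map (\<lambda>l. - (colombeau_const \<i> * complex_of_colombeau l)) ls))
       \<and> (nondegenerate n A \<longleftrightarrow> (\<forall>\<theta>\<in>set \<theta>s. \<theta> dvd 1))
       \<and> (nondegenerate n A \<longrightarrow>
            (\<exists>V. V \<in> carrier_mat n n \<and> nondegenerate n V \<and>
               transpose_mat V * A * V =
                 four_block_mat (0\<^sub>m (n div 2) (n div 2)) (- 1\<^sub>m (n div 2))
                                (1\<^sub>m (n div 2)) (0\<^sub>m (n div 2) (n div 2))))"
proof -
  note A = assms(1,2)
  define m where "m = n div 2"
  define z where "z x = colombeau_const \<i> * complex_of_colombeau x" for x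
  obtain V d l where V: "V \<in> carrier_mat n n" "transpose_mat V * V = 1\<^sub>m n" "V * transpose_mat V = 1\<^sub>m n"
    and D: "transpose_mat V * A * V = skew_diag n d"
    and rep: "\<And>q. q < m \<Longrightarrow> represents (\<lambda>\<epsilon>. l \<epsilon> q) (d q)"
    and l: "\<And>\<epsilon>. antimono (l \<epsilon>)" "\<And>\<epsilon> q. 0 \<le> l \<epsilon> q"
    and \<theta>: "\<And>k. k < n \<Longrightarrow> \<theta>s ! k = skew_eigenvalue n (\<lambda>q. z (d q)) k"
    unfolding m_def z_def using skew_colombeau_normal_form[OF assms] by blast
  have len: "length \<theta>s = n" using assms(3) by (simp add: distinguished_tuple_def)
  have \<theta>s: "\<theta>s = map (skew_eigenvalue n (\<lambda>q. z (d q))) [0..<n]"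
    using len \<theta> by (intro nth_equalityI) auto
  have z0: "z x = 0 \<longleftrightarrow> x = 0" for x unfolding z_def by (rule imaginary_multiple_eq_0_iff)
  \<comment> \<open>The number of nonzero blocks. The alternative \<open>q = m\<close> stops the
    search when no \<open>d q\<close> with \<open>q < m\<close> vanishes.\<close>
  define k where "k = (LEAST q. q = m \<or> d q = 0)"
  have k: "k = m \<or> d k = 0" unfolding k_def by (rule LeastI[of _ m]) simp
  have "k \<le> m" unfolding k_def by (rule Least_le) simp
  have d_nz: "d q \<noteq> 0" if "q < k" for q using not_less_Least[of q] that unfolding k_def by blast
  \<comment> \<open>The net of \<open>d k\<close> is negligible and dominates all later ones
    pointwise, so the nonzero classes form an initial segment.\<close>
  have d_z: "d q = 0" if "k \<le> q" "q < m" for q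
  proof -
    have "negligible_net (\<lambda>\<epsilon>. l \<epsilon> k)"
      using represents_eq_0_iff[OF rep[of k]] k that by auto
    moreover have "norm (l \<epsilon> q) \<le> norm (l \<epsilon> k)" for \<epsilon>
      using antimonoD[OF l(1)[of \<epsilon>] that(1)] l(2)[of \<epsilon> q] l(2)[of \<epsilon> k] by simp
    ultimately have "negligible_net (\<lambda>\<epsilon>. l \<epsilon> q)"
      by (rule negligible_net_norm_le[OF _ always_eventually[OF allI]])
    then show ?thesis using represents_eq_0_iff[OF rep[OF that(2)]] by simp
  qed
  define ls where "ls = map d [0..<k]"
  have part1: "V \<in> carrier_mat n n \<and> transpose_mat V * V = 1\<^sub>m n \<and>
      2 * length ls \<le> n \<and>
      transpose_mat V * A * V =
        diag_block_mat (map rotation_block ls @ replicate (n - 2 * length ls) (0\<^sub>m 1 1)) \<and>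
      sorted_wrt (\<ge>) ls \<and> (\<forall>l\<in>set ls. l \<ge> 0) \<and>
      filter_mset (\<lambda>\<theta>. \<theta> \<noteq> 0) (mset \<theta>s) = mset (map z ls) + mset (map (\<lambda>l. - z l) ls)"
  proof (intro conjI)
    show "2 * length ls \<le> n" using \<open>k \<le> m\<close> by (simp add: ls_def m_def)
    then have "2 * length ls + (n - 2 * length ls) = n" by simp
    then have "diag_block_mat (map rotation_block ls @ replicate (n - 2 * length ls) (0\<^sub>m 1 1)) =
        skew_diag n (\<lambda>q. if q < length ls then ls ! q else 0)"
      unfolding diag_block_rotations by simp
    also have "\<dots> = skew_diag n d"
    proof (rule eq_matI)
      fix i j assume "i < dim_row (skew_diag n d)" "j < dim_col (skew_diag n d)"
      then show "skew_diag n (\<lambda>q. if q < length ls then ls ! q else 0) $$ (i, j) = skew_diag n d $$ (i, j)"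
        using d_z[of "i div 2"] d_z[of "j div 2"] by (auto simp: ls_def not_less m_def elim!: evenE)
    qed auto
    finally show "transpose_mat V * A * V =
        diag_block_mat (map rotation_block ls @ replicate (n - 2 * length ls) (0\<^sub>m 1 1))"
      using D by simp
    have "d q \<le> d p" if "p \<le> q" "q < m" for p q
      unfolding less_eq_colombeau_def using rep[of p] rep[of q] antimonoD[OF l(1) that(1)] that
      by (intro exI[of _ "\<lambda>\<epsilon>. l \<epsilon> q"] exI[of _ "\<lambda>\<epsilon>. l \<epsilon> p"]) auto
    then show "sorted_wrt (\<ge>) ls"
      using \<open>k \<le> m\<close> by (auto simp: ls_def sorted_wrt_iff_nth_less)
    have "0 \<le> d q" if "q < m" for q
      unfolding less_eq_colombeau_def using rep[OF that] represents_0 l(2)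
      by (intro exI[of _ "\<lambda>_. 0"] exI[of _ "\<lambda>\<epsilon>. l \<epsilon> q"]) auto
    then show "\<forall>l\<in>set ls. l \<ge> 0" using \<open>k \<le> m\<close> by (auto simp: ls_def)
    have split: "[0..<m] = [0..<k] @ [k..<m]"
      using upt_add_eq_append[of 0 k "m - k"] \<open>k \<le> m\<close> by simp
    \<comment> \<open>Stated for any \<open>f\<close> that vanishes only at 0, so that
      \<open>z\<close> and its negative are covered together.\<close>
    have "filter_mset (\<lambda>\<theta>. \<theta> \<noteq> 0) (mset (map (\<lambda>q. f (d q)) [0..<m])) = mset (map f ls)"
      if f: "\<And>x. f x = 0 \<longleftrightarrow> x = 0" for f :: "real colombeau \<Rightarrow> complex colombeau"
    proof -
      have "filter (\<lambda>\<theta>. \<theta> \<noteq> 0) (map (\<lambda>q. f (d q)) [0..<k]) = map (\<lambda>q. f (d q)) [0..<k]"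
        by (rule filter_True) (use d_nz f in auto)
      moreover have "filter (\<lambda>\<theta>. \<theta> \<noteq> 0) (map (\<lambda>q. f (d q)) [k..<m]) = []"
        by (rule filter_False) (use d_z f in auto)
      ultimately have "filter (\<lambda>\<theta>. \<theta> \<noteq> 0) (map (\<lambda>q. f (d q)) [0..<m]) = map f ls"
        unfolding split map_append filter_append by (simp add: ls_def)
      then show ?thesis by (metis mset_filter)
    qed
    from this[of z] this[of "\<lambda>x. - z x"]
    show "filter_mset (\<lambda>\<theta>. \<theta> \<noteq> 0) (mset \<theta>s) = mset (map z ls) + mset (map (\<lambda>l. - z l) ls)"
      unfolding \<theta>s mset_skew_eigenvalues m_def[symmetric] by (simp add: z0 del: mset_map)
  qed (use V in auto)
  have symplectic: "\<exists>W. W \<in> carrier_mat n n \<and> transpose_mat W * A * W =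
      four_block_mat (0\<^sub>m m m) (- 1\<^sub>m m) (1\<^sub>m m) (0\<^sub>m m m) \<and> nondegenerate n W \<and> nondegenerate n A"
    if units: "\<forall>\<theta>\<in>set \<theta>s. \<theta> dvd 1"
  proof -
    have unit: "skew_eigenvalue n (\<lambda>q. z (d q)) k dvd 1" if "k < n" for k
      using units that len \<theta>[OF that] nth_mem by metis
    \<comment> \<open>For odd \<open>n\<close> the middle entry of the tuple is 0, which is not a
      unit.\<close>
    have n: "n = m + m"
    proof (rule ccontr)
      assume "n \<noteq> m + m"
      then have "m < n" "n - 1 - m = m" unfolding m_def by presburger+
      then show False using unit[of m] by (simp add: skew_eigenvalue_def m_def[symmetric])
    qed
    have "\<exists>c. c * c * d q = 1" if q: "q < m" for q
    proof -
      have "z (d q) dvd 1" using unit[of q] q n by (simp add: skew_eigenvalue_def m_def[symmetric])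
      then have "d q dvd 1" by (simp only: z_def imaginary_multiple_unit_iff)
      then show ?thesis using colombeau_unit_inverse_sqrt[OF rep[OF q] l(2)] by metis
    qed
    then obtain c where "\<And>q. q < m \<Longrightarrow> c q * c q * d q = 1" by metis
    from symplectic_congruence[OF A(1) V(1) D n this] obtain W where W: "W \<in> carrier_mat n n"
      "transpose_mat W * A * W = four_block_mat (0\<^sub>m m m) (- 1\<^sub>m m) (1\<^sub>m m) (0\<^sub>m m m)" by blast
    \<comment> \<open>The unit determinant of the symplectic matrix has \<open>det A\<close> and
      \<open>det W\<close> as factors, so both are units.\<close>
    have "det (transpose_mat W * A * W) = det (transpose_mat W * A) * det W"
      by (rule det_mult[of _ n]) (use W A in auto)
    also have "det (transpose_mat W * A) = det (transpose_mat W) * det A"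
      by (rule det_mult[of _ n]) (use W A in auto)
    finally have "det W dvd det (transpose_mat W * A * W)" "det A dvd det (transpose_mat W * A * W)"
      by (simp_all add: mult.assoc)
    then have "det W dvd 1" "det A dvd 1"
      unfolding W(2) using det_symplectic_unit dvd_trans by blast+
    then show ?thesis using W A nondegenerate_if_det_unit by blast
  qed
  have degenerate: "\<theta> dvd 1" if nondeg: "nondegenerate n A" and mem: "\<theta> \<in> set \<theta>s" for \<theta>
  proof (rule ccontr)
    assume non_unit: "\<not> \<theta> dvd 1"
    obtain k where k: "k < n" "\<theta> = skew_eigenvalue n (\<lambda>q. z (d q)) k"
      using mem len \<theta> by (metis in_set_conv_nth)
    \<comment> \<open>A non-unit \<open>\<theta>\<close> is either plus or minus
      \<open>z (d q)\<close>, and an annihilator of \<open>d q\<close> kills column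
      \<open>2 * q\<close>, or it is the middle 0 for odd \<open>n\<close>, where the last column
      vanishes and 1 serves as \<open>c\<close>.\<close>
    have "\<exists>j<n. \<exists>c. c \<noteq> 0 \<and> (\<forall>i<n. c * skew_diag n d $$ (i, j) = 0)"
    proof (cases "\<exists>q<m. \<theta> = z (d q) \<or> \<theta> = - z (d q)")
      case True
      then obtain q where q: "q < m" "\<not> d q dvd 1"
        using non_unit unfolding z_def by (metis imaginary_multiple_unit_iff minus_dvd_iff)
      then obtain c where "c \<noteq> 0" "c * d q = 0" using colombeau_non_unit_annihilator by blast
      moreover have "2 * q \<noteq> Suc i" if "even i" for i using that by presburger
      ultimately show ?thesis using q(1)
        by (intro exI[of _ "2 * q"] conjI exI[of _ c]) (auto simp: m_def)
    next
      case False
      then have "\<not> k < m" using k(2) by (auto simp: skew_eigenvalue_def m_def[symmetric])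
      moreover from this have "\<not> n - 1 - k < m"
        using False k(2) by (auto simp: skew_eigenvalue_def m_def[symmetric])
      ultimately have "odd n" using k(1) unfolding m_def by presburger
      then have "even (n - 1)" "0 < n" by (auto elim: oddE)
      moreover from this have "n - 1 \<noteq> Suc i" if "even i" for i
        using that by presburger
      ultimately show ?thesis
        by (intro exI[of _ "n - 1"] conjI exI[of _ 1]) auto
    qed
    then show False
      using degenerate_if_col_annihilated[OF A V] nondeg unfolding D by blast
  qed
  show ?thesis
    using part1 symplectic degenerate unfolding z_def m_def by blast
qed

end
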